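(* Let $X$ be a Banach space. If $\Gamma:[0,1]\to cwk(X)$ is a bounded multifunction which is variationally Henstock integrable and Pettis integrable, then $\mathcal{S}_{vMS}(\Gamma)\neq\emptyset$.
   Context: $[0,1]$ carries Lebesgue measure $\lambda$; $\mathcal{L}$ is the family of Lebesgue measurable subsets, $\mathcal{I}$ the family of all closed subintervals of $[0,1]$, $|I|$ the length of $I$. $cwk(X)$ is the family of all non-empty convex weakly compact subsets of $X$, with Minkowski addition, multiplication by scalars, and the Hausdorff distance $d_H$; $\|A\|=\sup\{\|x\|:x\in A\}$; $s(x^*,C)=\sup\{\langle x^*,x\rangle:x\in C\}$. $\Gamma$ is bounded if $\sup_{t\in[0,1]}\|\Gamma(t)\|<\infty$. A function $f:[0,1]\to X$ is a selection of $\Gamma$ if $f(t)\in\Gamma(t)$ for every $t$; it is scalarly measurable if $x^*f$ is measurable for every $x^*\in X^*$. A gauge is a function $\delta:[0,1]\to(0,\infty)$. A partition of $[0,1]$ is a finite collection $\{(I_1,t_1),\dots,(I_p,t_p)\}$ of non-overlapping closed subintervals with union $[0,1]$ and points $t_i\in[0,1]$; it is a Perron partition if $t_i\in I_i$ for all $i$; it is $\delta$-fine if $I_i\subset(t_i-\delta(t_i),t_i+\delta(t_i))$ for all $i$. $\Gamma$ is variationally Henstock (resp. variationally McShane) integrable if there is a finitely additive $\Phi_\Gamma:\mathcal{I}\to cwk(X)$ such that for every $\varepsilon>0$ there is a gauge $\delta$ with $\sum_{j=1}^p d_H(\Phi_\Gamma(I_j),\Gamma(t_j)|I_j|)<\varepsilon$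 for every $\delta$-fine Perron partition (resp. $\delta$-fine partition) of $[0,1]$. For functions $f:[0,1]\to X$ the same definitions are used with $f$ identified with $t\mapsto\{f(t)\}$ and primitives taking values in $X$. $\Gamma$ is Pettis integrable (in $cwk(X)$) if $s(x^*,\Gamma(\cdot))$ is Lebesgue integrable for every $x^*\in X^*$ and for every $E\in\mathcal{L}$ there is $M_\Gamma(E)\in cwk(X)$ with $s(x^*,M_\Gamma(E))=\int_E s(x^*,\Gamma(t))\,dt$ for all $x^*\in X^*$. $\mathcal{S}_{vMS}(\Gamma)$ is the family of all scalarly measurable selections of $\Gamma$ that are variationally McShane integrable. *)

theory Defs
  imports "HOL-Analysis.Analysis" "HOL-Library.Set_Algebras"
begin

text \<open>
  Functions and multifunctions on the unit interval are total functions on \<^typ>\<open>real\<close>; only their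
  values on \<open>{0..1}\<close> are ever referred to. The dual space of \<^typ>\<open>'a\<close> is the type of bounded
  linear functionals \<open>'a \<Rightarrow>\<^sub>L real\<close>.
\<close>

subsection \<open>Convex weakly compact sets\<close>

definition weak_topology :: "'a::real_normed_vector topology" where
  "weak_topology =
     topology_generated_by {blinfun_apply x' -` U | (x' :: 'a \<Rightarrow>\<^sub>L real) U. open U}"

definition cwk :: "'a::real_normed_vector set set" where
  "cwk = {C. C \<noteq> {} \<and> convex C \<and> compactin weak_topology C}"

text \<open>
  The suprema below are taken in \<^typ>\<open>real\<close> and so are meaningful only for non-empty, norm bounded
  sets. Members of \<open>cwk\<close> are such sets: weakly compact sets are norm bounded.
\<close>

definition support_fun :: "('a::real_normed_vector \<Rightarrow>\<^sub>L real) \<Rightarrow> 'a set \<Rightarrow> real" where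
  "support_fun x' C = (SUP x\<in>C. blinfun_apply x' x)"

definition set_norm :: "'a::real_normed_vector set \<Rightarrow> real" where
  "set_norm A = (SUP x\<in>A. norm x)"

definition hausdorff_distance :: "'a::real_normed_vector set \<Rightarrow> 'a set \<Rightarrow> real" where
  "hausdorff_distance A B = max (SUP a\<in>A. infdist a B) (SUP b\<in>B. infdist b A)"

definition bounded_multifunction :: "(real \<Rightarrow> 'a::real_normed_vector set) \<Rightarrow> bool" where
  "bounded_multifunction \<Gamma> \<longleftrightarrow> bdd_above ((\<lambda>t. set_norm (\<Gamma> t)) ` {0..1})"

subsection \<open>Partitions of the unit interval\<close>

text \<open>
  Intervals are non-degenerate. Consequently non-overlapping intervals are distinct, and a
  partition can be represented by a finite set of pairs. Admitting degenerate intervals would not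
  change the integrals: additivity forces a primitive to be \<open>{0}\<close> on them.
\<close>

definition subintervals :: "real set set" where
  "subintervals = {{a..b} | a b. 0 \<le> a \<and> a < b \<and> b \<le> 1}"

definition nonoverlapping :: "real set \<Rightarrow> real set \<Rightarrow> bool" where
  "nonoverlapping I J \<longleftrightarrow> interior I \<inter> interior J = {}"

definition tagged_partition :: "(real set \<times> real) set \<Rightarrow> bool" where
  "tagged_partition P \<longleftrightarrow>
     finite P \<and>
     (\<forall>(I, t)\<in>P. I \<in> subintervals \<and> t \<in> {0..1}) \<and>
     pairwise (\<lambda>p q. nonoverlapping (fst p) (fst q)) P \<and>
     (\<Union>(I, t)\<in>P. I) = {0..1}"

definition perron_partition :: "(real set \<times> real) set \<Rightarrow> bool" where
  "perron_partition P \<longleftrightarrow> tagged_partition P \<and> (\<forall>(I, t)\<in>P. t \<in> I)"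

definition gauge_fine :: "(real \<Rightarrow> real) \<Rightarrow> (real set \<times> real) set \<Rightarrow> bool" where
  "gauge_fine \<delta> P \<longleftrightarrow> (\<forall>(I, t)\<in>P. I \<subseteq> {t - \<delta> t <..< t + \<delta> t})"

subsection \<open>Variational integrals\<close>

text \<open>The sum of two sets is the Minkowski sum, as in \<^theory>\<open>HOL-Library.Set_Algebras\<close>.\<close>

definition finitely_additive :: "(real set \<Rightarrow> 'a::real_normed_vector set) \<Rightarrow> bool" where
  "finitely_additive \<Phi> \<longleftrightarrow>
     (\<forall>I\<in>subintervals. \<forall>J\<in>subintervals.
        nonoverlapping I J \<and> I \<union> J \<in> subintervals \<longrightarrow> \<Phi> (I \<union> J) = \<Phi> I + \<Phi> J)"

text \<open>
  The first argument is the class of admissible partitions: \<^const>\<open>perron_partition\<close> for the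
  Henstock integral, \<^const>\<open>tagged_partition\<close> for the McShane integral.
\<close>

definition variational_primitive ::
  "((real set \<times> real) set \<Rightarrow> bool) \<Rightarrow> (real set \<Rightarrow> 'a::real_normed_vector set) \<Rightarrow>
     (real \<Rightarrow> 'a set) \<Rightarrow> bool" where
  "variational_primitive admissible \<Phi> \<Gamma> \<longleftrightarrow>
     finitely_additive \<Phi> \<and>
     (\<forall>\<epsilon>>0. \<exists>\<delta>. (\<forall>t\<in>{0..1}. \<delta> t > 0) \<and>
        (\<forall>P. admissible P \<and> gauge_fine \<delta> P \<longrightarrow>
           (\<Sum>(I, t)\<in>P. hausdorff_distance (\<Phi> I) ((*\<^sub>R) (measure lborel I) ` \<Gamma> t)) < \<epsilon>))"

definition variationally_Henstock_integrable ::
  "(real \<Rightarrow> 'a::real_normed_vector set) \<Rightarrow> bool" where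
  "variationally_Henstock_integrable \<Gamma> \<longleftrightarrow>
     (\<exists>\<Phi>. (\<forall>I\<in>subintervals. \<Phi> I \<in> cwk) \<and> variational_primitive perron_partition \<Phi> \<Gamma>)"

text \<open>
  For a vector-valued function \<open>f\<close>, identified with \<open>t \<mapsto> {f t}\<close>, the primitive takes values
  in the space itself, that is, in its singletons.
\<close>

definition variationally_McShane_integrable_fun ::
  "(real \<Rightarrow> 'a::real_normed_vector) \<Rightarrow> bool" where
  "variationally_McShane_integrable_fun f \<longleftrightarrow>
     (\<exists>\<phi>. variational_primitive tagged_partition (\<lambda>I. {\<phi> I}) (\<lambda>t. {f t}))"

subsection \<open>Pettis integrability and selections\<close>

definition Pettis_integrable :: "(real \<Rightarrow> 'a::real_normed_vector set) \<Rightarrow> bool" where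
  "Pettis_integrable \<Gamma> \<longleftrightarrow>
     (\<forall>x'. integrable (lebesgue_on {0..1}) (\<lambda>t. support_fun x' (\<Gamma> t))) \<and>
     (\<forall>E\<in>sets (lebesgue_on {0..1}). \<exists>M\<in>cwk.
        \<forall>x'. support_fun x' M = (LINT t:E|lebesgue_on {0..1}. support_fun x' (\<Gamma> t)))"

definition selection :: "(real \<Rightarrow> 'a) \<Rightarrow> (real \<Rightarrow> 'a set) \<Rightarrow> bool" where
  "selection f \<Gamma> \<longleftrightarrow> (\<forall>t\<in>{0..1}. f t \<in> \<Gamma> t)"

definition scalarly_measurable :: "(real \<Rightarrow> 'a::real_normed_vector) \<Rightarrow> bool" where
  "scalarly_measurable f \<longleftrightarrow>
     (\<forall>x' :: 'a \<Rightarrow>\<^sub>L real. (\<lambda>t. blinfun_apply x' (f t)) \<in> borel_measurable (lebesgue_on {0..1}))"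

definition S_vMS :: "(real \<Rightarrow> 'a::real_normed_vector set) \<Rightarrow> (real \<Rightarrow> 'a) set" where
  "S_vMS \<Gamma> =
     {f. selection f \<Gamma> \<and> scalarly_measurable f \<and> variationally_McShane_integrable_fun f}"

end

theory Submission
  imports Defs
begin

text \<open>
  Let \<open>\<Phi>\<close> be a variational primitive of \<open>\<Gamma>\<close>. On the dyadic cell \<open>I\<close> of level \<open>n\<close> containing \<open>t\<close> put
  \<open>G n t = \<Phi> I / |I|\<close>. The variational inequality makes \<open>\<Phi>\<close> differentiable along the dyadic
  cells: \<open>G n t\<close> tends to \<open>\<Gamma> t\<close> in the Hausdorff distance for almost every \<open>t\<close>. The
  reason is that the cells at which \<open>\<Phi>\<close> deviates from \<open>\<Gamma>\<close> can be collected from the top of the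
  dyadic tree downwards, which turns them into members of one fine partition; its variational sum
  is small, so their total length is small
  (\<open>partition_through_marked_cells\<close>, \<open>variation_on_cells_tendsto_zero\<close>).

  So \<open>\<Gamma>\<close> is almost everywhere a limit of multifunctions that are constant on dyadic cells,
  and a selection can be obtained as a limit of functions that are constant on dyadic cells.
  Convergence almost everywhere gives levels \<open>\<nu> 0 < \<nu> 1 < \<dots>\<close> at which consecutive \<open>G (\<nu> k)\<close>
  differ by at most \<open>(1/2)^k\<close> off a set of measure less than \<open>(1/2)^k\<close>. Start with a point of \<open>G (\<nu> 0) t\<close> and move at each step to an almost nearest point of
  the next set. Almost everywhere the points converge, and the limit lies in the closed set \<open>\<Gamma> t\<close>;
  on the exceptional null set any point of \<open>\<Gamma> t\<close> will do (\<open>selection_of_dyadic_limit\<close>).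

  The selection \<open>f\<close> is, off open sets of arbitrarily small measure, uniformly close to functions
  that are constant on the dyadic cells (\<open>step_approximable\<close>). For such a function with norm bounded
  by \<open>M\<close> there is one inequality behind everything else: with a suitable gauge,
  \<open>norm (f s - f t) \<le> \<epsilon> + 2 * M * indicator U s\<close> whenever \<open>s\<close> is within the gauge of \<open>t\<close>, where \<open>U\<close> is
  open and small. Integrated over a fine McShane partition it bounds the variation by
  \<open>\<epsilon> + 2 * M * measure U\<close>. The primitive is the Henstock-Kurzweil integral of \<open>f\<close>.

  Weak compactness enters through two consequences: the values of \<open>\<Gamma>\<close> and \<open>\<Phi>\<close> are
  norm closed and norm bounded. Both rest on the existence of norming functionals; boundedness is
  the uniform boundedness principle applied in the dual space.
\<close>

section \<open>Norming functionals\<close>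

text \<open>
  Positive homogeneity is assumed only as an inequality and only for positive factors; the equality,
  and the value at zero, follow.
\<close>
definition sublinear :: "('a::real_vector \<Rightarrow> real) \<Rightarrow> bool" where
  "sublinear p \<longleftrightarrow> (\<forall>x y. p (x + y) \<le> p x + p y) \<and> (\<forall>c>0. \<forall>x. p (c *\<^sub>R x) \<le> c * p x)"

lemma sublinear_add: "sublinear p \<Longrightarrow> p (x + y) \<le> p x + p y"
  by (simp add: sublinear_def)

lemma sublinear_zero:
  assumes "sublinear p" shows "p 0 = 0"
proof -
  have "p 0 \<le> p 0 + p 0" using sublinear_add[OF assms, of 0 0] by simp
  moreover have "p ((1/2) *\<^sub>R 0) \<le> (1/2) * p 0"
    using assms by (simp only: sublinear_def zero_less_divide_iff zero_less_one zero_less_numeral simp_thms)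
  ultimately show ?thesis by simp
qed

lemma sublinear_scaleR:
  assumes "sublinear p" "c \<ge> 0" shows "p (c *\<^sub>R x) = c * p x"
proof (cases "c = 0")
  case True then show ?thesis using sublinear_zero[OF assms(1)] by simp
next
  case False
  then have c: "c > 0" using assms by simp
  have "p (c *\<^sub>R x) \<le> c * p x" using assms c by (simp add: sublinear_def)
  moreover have "p ((1/c) *\<^sub>R (c *\<^sub>R x)) \<le> (1/c) * p (c *\<^sub>R x)"
    using assms c unfolding sublinear_def by (meson zero_less_divide_1_iff)
  then have "c * p x \<le> p (c *\<^sub>R x)" using c by (simp add: field_simps)
  ultimately show ?thesis by simp
qed

lemma sublinear_minus: "sublinear p \<Longrightarrow> - p (- x) \<le> p x"
  using sublinear_add[of p x "-x"] sublinear_zero[of p] by simp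

text \<open>
  The largest sublinear functional below \<open>p\<close> that takes the value \<open>- p v\<close> at \<open>- v\<close>. A minimal
  sublinear functional is invariant under tilting, and this makes it additive; tilting the norm
  makes a functional attain the norm of \<open>v\<close>.
\<close>
definition tilt :: "('a::real_vector \<Rightarrow> real) \<Rightarrow> 'a \<Rightarrow> 'a \<Rightarrow> real" where
  "tilt p v y = (INF t\<in>{0..}. p (y + t *\<^sub>R v) - t * p v)"

lemma tilt_bound:
  assumes "sublinear p" "t \<ge> 0"
  shows "- p (- y) \<le> p (y + t *\<^sub>R v) - t * p v"
proof -
  have "t * p v = p ((y + t *\<^sub>R v) + (- y))" using sublinear_scaleR[OF assms] by simp
  also have "\<dots> \<le> p (y + t *\<^sub>R v) + p (- y)" by (rule sublinear_add[OF assms(1)])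
  finally show ?thesis by simp
qed

lemma tilt_le:
  assumes "sublinear p" "t \<ge> 0"
  shows "tilt p v y \<le> p (y + t *\<^sub>R v) - t * p v"
  unfolding tilt_def
proof (rule cINF_lower)
  show "bdd_below ((\<lambda>t. p (y + t *\<^sub>R v) - t * p v) ` {0..})"
    by (rule bdd_belowI2[where m="- p (- y)"], rule tilt_bound[OF assms(1)]) simp
  show "t \<in> {0..}" using assms(2) by simp
qed

lemma tilt_greatest:
  assumes "\<And>t. t \<ge> 0 \<Longrightarrow> c \<le> p (y + t *\<^sub>R v) - t * p v"
  shows "c \<le> tilt p v y"
  unfolding tilt_def by (rule cINF_greatest) (use assms in auto)

lemma sublinear_tilt:
  assumes "sublinear p" shows "sublinear (tilt p v)"
  unfolding sublinear_def
proof (intro conjI allI impI)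
  fix x y
  have "tilt p v (x + y) - tilt p v y \<le> tilt p v x"
  proof (rule tilt_greatest)
    fix s :: real assume s: "s \<ge> 0"
    have "tilt p v (x + y) - (p (x + s *\<^sub>R v) - s * p v) \<le> tilt p v y"
    proof (rule tilt_greatest)
      fix t :: real assume t: "t \<ge> 0"
      have "tilt p v (x + y) \<le> p ((x + y) + (s + t) *\<^sub>R v) - (s + t) * p v"
        using s t by (intro tilt_le[OF assms]) simp
      also have "p ((x + y) + (s + t) *\<^sub>R v) \<le> p (x + s *\<^sub>R v) + p (y + t *\<^sub>R v)"
        using sublinear_add[OF assms, of "x + s *\<^sub>R v" "y + t *\<^sub>R v"] by (simp add: algebra_simps)
      finally show "tilt p v (x + y) - (p (x + s *\<^sub>R v) - s * p v) \<le> p (y + t *\<^sub>R v) - t * p v"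
        by (simp add: algebra_simps)
    qed
    then show "tilt p v (x + y) - tilt p v y \<le> p (x + s *\<^sub>R v) - s * p v" by simp
  qed
  then show "tilt p v (x + y) \<le> tilt p v x + tilt p v y" by simp
next
  fix c :: real and x assume c: "c > 0"
  have "tilt p v (c *\<^sub>R x) / c \<le> tilt p v x"
  proof (rule tilt_greatest)
    fix t :: real assume t: "t \<ge> 0"
    have "tilt p v (c *\<^sub>R x) \<le> p (c *\<^sub>R x + (c * t) *\<^sub>R v) - (c * t) * p v"
      using c t by (intro tilt_le[OF assms]) simp
    also have "c *\<^sub>R x + (c * t) *\<^sub>R v = c *\<^sub>R (x + t *\<^sub>R v)" by (simp add: algebra_simps)
    also have "p \<dots> = c * p (x + t *\<^sub>R v)" using c by (intro sublinear_scaleR[OF assms]) simp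
    finally show "tilt p v (c *\<^sub>R x) / c \<le> p (x + t *\<^sub>R v) - t * p v"
      using c by (simp add: field_simps)
  qed
  then show "tilt p v (c *\<^sub>R x) \<le> c * tilt p v x" using c by (simp add: field_simps)
qed

lemma tilt_below: "sublinear p \<Longrightarrow> tilt p v \<le> p"
  using tilt_le[of p 0] by (simp add: le_fun_def)

text \<open>
  Zorn's lemma for the reversed pointwise order. The infimum of a chain is finite because a
  sublinear functional \<open>p \<le> q\<close> satisfies \<open>p y \<ge> - p (- y) \<ge> - q (- y)\<close>.
\<close>
lemma exists_minimal_sublinear:
  assumes "sublinear q"
  obtains p where "sublinear p" "p \<le> q" "\<And>r. sublinear r \<Longrightarrow> r \<le> p \<Longrightarrow> r = p"
proof -
  define A where "A = {p. sublinear p \<and> p \<le> q}"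
  have "\<exists>m\<in>A. \<forall>a\<in>A. a \<le> m \<longrightarrow> a = m"
  proof (rule predicate_Zorn)
    show "partial_order_on A (relation_of (\<lambda>a b. b \<le> a) A)"
      by (rule partial_order_on_relation_ofI) auto
  next
    fix C assume C: "C \<in> Chains (relation_of (\<lambda>a b. b \<le> a) A)"
    have CA: "C \<subseteq> A" and chain: "\<And>a b. a \<in> C \<Longrightarrow> b \<in> C \<Longrightarrow> a \<le> b \<or> b \<le> a"
      using C by (auto simp: Chains_def relation_of_def)
    show "\<exists>u\<in>A. \<forall>a\<in>C. u \<le> a"
    proof (cases "C = {}")
      case True then show ?thesis using assms by (auto simp: A_def)
    next
      case False
      define u where "u y = (INF p\<in>C. p y)" for y
      have bound: "- q (- y) \<le> p y" if "p \<in> C" for p y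
      proof -
        have "sublinear p" "p (- y) \<le> q (- y)" using that CA by (auto simp: A_def le_fun_def)
        then show ?thesis using sublinear_minus[of p y] by linarith
      qed
      have u_le: "u y \<le> p y" if "p \<in> C" for p y
        unfolding u_def by (rule cINF_lower[OF bdd_belowI2[where m="- q (- y)"] that]) (rule bound)
      have u_greatest: "c \<le> u y" if "\<And>p. p \<in> C \<Longrightarrow> c \<le> p y" for c y
        unfolding u_def by (rule cINF_greatest) (use that False in auto)
      have "sublinear u" unfolding sublinear_def
      proof (intro conjI allI impI)
        fix x y
        have "u (x + y) - u y \<le> u x"
        proof (rule u_greatest)
          fix p assume p: "p \<in> C"
          have "u (x + y) - p x \<le> u y"
          proof (rule u_greatest)
            fix r assume r: "r \<in> C"
            \<comment> \<open>Both functionals dominate the smaller of the two, as they belong to a chain.\<close>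
            obtain s where s: "s \<in> C" "s \<le> p" "s \<le> r" using chain[OF p r] p r by auto
            have "u (x + y) \<le> s (x + y)" by (rule u_le[OF s(1)])
            also have "\<dots> \<le> s x + s y" using s CA by (auto simp: A_def intro: sublinear_add)
            also have "\<dots> \<le> p x + r y" using s by (auto simp: le_fun_def intro: add_mono)
            finally show "u (x + y) - p x \<le> r y" by simp
          qed
          then show "u (x + y) - u y \<le> p x" by simp
        qed
        then show "u (x + y) \<le> u x + u y" by simp
      next
        fix c :: real and x assume c: "c > 0"
        have "u (c *\<^sub>R x) / c \<le> u x"
        proof (rule u_greatest)
          fix p assume p: "p \<in> C"
          have "u (c *\<^sub>R x) \<le> p (c *\<^sub>R x)" by (rule u_le[OF p])
          also have "\<dots> = c * p x" using p CA c by (intro sublinear_scaleR) (auto simp: A_def)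
          finally show "u (c *\<^sub>R x) / c \<le> p x" using c by (simp add: field_simps)
        qed
        then show "u (c *\<^sub>R x) \<le> c * u x" using c by (simp add: field_simps)
      qed
      moreover have "u \<le> q"
      proof -
        obtain p where p: "p \<in> C" using False by blast
        then have "u y \<le> p y" "p y \<le> q y" for y using CA u_le by (auto simp: A_def le_fun_def)
        then show ?thesis by (meson le_funI order_trans)
      qed
      ultimately show ?thesis using u_le by (auto simp: A_def le_fun_def)
    qed
  qed
  then obtain m where m: "m \<in> A" "\<And>a. a \<in> A \<Longrightarrow> a \<le> m \<Longrightarrow> a = m" by blast
  show ?thesis
    by (rule that[of m]) (use m in \<open>auto simp: A_def\<close>)
qed

text \<open>
  Tilting in the direction \<open>v\<close> changes nothing, so \<open>p y \<le> p (y + v) - p v\<close>; together with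
  subadditivity this is additivity.
\<close>
lemma minimal_sublinear_linear:
  assumes p: "sublinear p" and min: "\<And>r. sublinear r \<Longrightarrow> r \<le> p \<Longrightarrow> r = p"
  shows "linear p"
proof -
  have add: "p (y + v) = p y + p v" for y v
  proof -
    have "tilt p v = p" by (rule min[OF sublinear_tilt[OF p] tilt_below[OF p]])
    then have "p y \<le> p (y + v) - p v" using tilt_le[OF p, of 1 v y] by simp
    then show ?thesis using sublinear_add[OF p, of y v] by simp
  qed
  then have neg: "p (- y) = - p y" for y
    using add[of y "-y"] sublinear_zero[OF p] by simp
  have "p (c *\<^sub>R y) = c *\<^sub>R p y" for c y
  proof (cases "c \<ge> 0")
    case True then show ?thesis using sublinear_scaleR[OF p] by simp
  next
    case False
    then have "p ((- c) *\<^sub>R y) = - c * p y" by (intro sublinear_scaleR[OF p]) simp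
    then show ?thesis using neg[of "c *\<^sub>R y"] by simp
  qed
  then show ?thesis using add by (intro linearI)
qed

text \<open>
  This is the Hahn-Banach theorem in the one form required here. A minimal sublinear functional below
  the norm tilted along \<open>x\<close> is linear, is at most the norm, and is at most \<open>- norm x\<close> at \<open>- x\<close>.
\<close>
lemma norming_functional:
  fixes x :: "'a::real_normed_vector"
  obtains x' :: "'a \<Rightarrow>\<^sub>L real" where "norm x' \<le> 1" "blinfun_apply x' x = norm x"
proof -
  have n: "sublinear (norm :: 'a \<Rightarrow> real)"
    by (simp add: sublinear_def norm_triangle_ineq)
  have t: "sublinear (tilt norm x)" by (rule sublinear_tilt[OF n])
  obtain p where p: "sublinear p" "p \<le> tilt norm x" and min: "\<And>r. sublinear r \<Longrightarrow> r \<le> p \<Longrightarrow> r = p"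
    using exists_minimal_sublinear[OF t] by blast
  have lin: "linear p" by (rule minimal_sublinear_linear[OF p(1) min])
  have le: "p y \<le> norm y" for y
    using p(2) tilt_below[OF n, of x] by (meson le_fun_def order_trans)
  have abs: "\<bar>p y\<bar> \<le> norm y" for y
    using le[of y] le[of "-y"] linear_neg[OF lin, of y] by simp
  have "p (- x) \<le> tilt norm x (- x)" using p(2) by (simp add: le_fun_def)
  also have "\<dots> \<le> norm (- x + 1 *\<^sub>R x) - 1 * norm x" by (rule tilt_le[OF n]) simp
  finally have "norm x \<le> p x" using linear_neg[OF lin, of x] by simp
  then have px: "p x = norm x" using le[of x] by simp
  have bl: "bounded_linear p"
    using lin abs by (auto intro!: bounded_linear_intro[where K=1] simp: linear_add linear_scale)
  show ?thesis
  proof (rule that[of "Blinfun p"])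
    show "norm (Blinfun p) \<le> 1"
      by (rule norm_blinfun_bound) (use abs bl in \<open>auto simp: bounded_linear_Blinfun_apply\<close>)
    show "blinfun_apply (Blinfun p) x = norm x" using px bl by (simp add: bounded_linear_Blinfun_apply)
  qed
qed

text \<open>
  Uniform boundedness for the elements of \<open>C\<close>, regarded as functionals on the dual space, which is
  complete. Norming functionals turn the resulting bound back into a bound of the norm on \<open>C\<close>.
\<close>
lemma bounded_if_scalarly_bounded:
  fixes C :: "'a::real_normed_vector set"
  assumes "\<And>x' :: 'a \<Rightarrow>\<^sub>L real. bounded (blinfun_apply x' ` C)"
  shows "bounded C"
proof -
  define E where "E n = {x' :: 'a \<Rightarrow>\<^sub>L real. \<forall>x\<in>C. \<bar>blinfun_apply x' x\<bar> \<le> real n}" for n :: nat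
  have closedE: "closed (E n)" for n
  proof -
    have "E n = (\<Inter>x\<in>C. {x'. \<bar>blinfun_apply x' x\<bar> \<le> real n})" by (auto simp: E_def)
    moreover have "closed {x' :: 'a \<Rightarrow>\<^sub>L real. \<bar>blinfun_apply x' x\<bar> \<le> real n}" for x
      by (intro closed_Collect_le continuous_intros)
    ultimately show ?thesis by auto
  qed
  have union: "(\<Union>n. E n) = UNIV"
  proof -
    have "\<exists>n. x' \<in> E n" for x'
    proof -
      obtain a where "\<forall>x\<in>C. norm (blinfun_apply x' x) \<le> a"
        using assms[of x'] by (auto simp: bounded_iff)
      moreover obtain n :: nat where "a \<le> real n" using real_arch_simple by blast
      ultimately have "\<forall>x\<in>C. \<bar>blinfun_apply x' x\<bar> \<le> real n" by (metis order_trans real_norm_def)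
      then show ?thesis unfolding E_def by blast
    qed
    then show ?thesis by blast
  qed
  have "\<exists>n. interior (E n) \<noteq> {}"
  proof (rule ccontr)
    assume "\<not> ?thesis"
    then have "euclidean interior_of (\<Union>(range E)) = {}"
      by (intro Baire_category_alt)
         (auto simp: closedE interior_of_def interior_def completely_metrizable_space_euclidean)
    then show False using union by simp
  qed
  then obtain n x0 where "x0 \<in> interior (E n)" by blast
  then obtain r where r: "r > 0" "cball x0 r \<subseteq> E n"
    by (meson mem_interior_cball)
  have "norm x \<le> 2 * real n / r" if x: "x \<in> C" for x
  proof -
    obtain x' :: "'a \<Rightarrow>\<^sub>L real" where x': "norm x' \<le> 1" "blinfun_apply x' x = norm x"
      by (rule norming_functional)
    have "x0 + r *\<^sub>R x' \<in> cball x0 r" using r x' by (simp add: dist_norm)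
    then have "\<bar>blinfun_apply (x0 + r *\<^sub>R x') x\<bar> \<le> real n" using r x by (auto simp: E_def)
    moreover have "\<bar>blinfun_apply x0 x\<bar> \<le> real n"
      using r x by (auto simp: E_def subset_iff)
    ultimately have "r * norm x \<le> 2 * real n"
      using x' by (simp add: blinfun.add_left blinfun.scaleR_left)
    then show ?thesis using r by (simp add: field_simps)
  qed
  then show ?thesis by (auto simp: bounded_iff)
qed

section \<open>Convex weakly compact sets are closed and bounded\<close>

lemma openin_weak_vimage:
  fixes x' :: "'a::real_normed_vector \<Rightarrow>\<^sub>L real"
  assumes "open U" shows "openin weak_topology (blinfun_apply x' -` U)"
  unfolding weak_topology_def
  by (rule topology_generated_by_Basis, rule CollectI, rule exI[of _ x'], rule exI[of _ U])
     (simp add: assms)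

lemma topspace_weak_topology [simp]: "topspace weak_topology = UNIV"
  using openin_subset[OF openin_weak_vimage[of UNIV 0]] by (intro top.extremum_uniqueI) simp

lemma openin_weak_imp_open:
  assumes "openin weak_topology U" shows "open U"
proof -
  have "generate_topology_on {blinfun_apply x' -` U | (x' :: 'a \<Rightarrow>\<^sub>L real) U. open U} U"
    using assms unfolding weak_topology_def by (rule openin_topology_generated_by)
  then show ?thesis
  proof induction
    case (Basis s)
    then show ?case by (auto intro!: open_vimage linear_continuous_on blinfun.bounded_linear_right)
  qed auto
qed

text \<open>
  Distinct points are separated by a functional that norms their difference.
\<close>
lemma Hausdorff_space_weak_topology:
  "Hausdorff_space (weak_topology :: 'a::real_normed_vector topology)"
  unfolding Hausdorff_space_def
proof (intro allI impI)
  fix x y :: 'a assume "x \<in> topspace weak_topology \<and> y \<in> topspace weak_topology \<and> x \<noteq> y"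
  then have "x \<noteq> y" by simp
  obtain x' :: "'a \<Rightarrow>\<^sub>L real" where "blinfun_apply x' (x - y) = norm (x - y)"
    by (rule norming_functional)
  then have "blinfun_apply x' x \<noteq> blinfun_apply x' y" using \<open>x \<noteq> y\<close> by (auto simp: blinfun.diff_right)
  then obtain U V where "open U" "open V" "blinfun_apply x' x \<in> U" "blinfun_apply x' y \<in> V" "U \<inter> V = {}"
    using hausdorff by meson
  then show "\<exists>U V. openin weak_topology U \<and> openin weak_topology V \<and> x \<in> U \<and> y \<in> V \<and> disjnt U V"
    by (intro exI[of _ "blinfun_apply x' -` U"] exI[of _ "blinfun_apply x' -` V"])
       (auto simp: openin_weak_vimage disjnt_def)
qed

text \<open>
  Compact sets are closed in the Hausdorff weak topology, and weakly open sets are open.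
\<close>
lemma cwk_closed:
  assumes "C \<in> cwk" shows "closed C"
proof -
  have "closedin weak_topology C"
    using assms Hausdorff_space_weak_topology by (auto simp: cwk_def intro: compactin_imp_closedin)
  then have "openin weak_topology (- C)" by (simp add: closedin_def Compl_eq_Diff_UNIV)
  then show ?thesis using openin_weak_imp_open by (auto simp: closed_def)
qed

lemma cwk_bounded:
  assumes "C \<in> cwk" shows "bounded C"
proof (rule bounded_if_scalarly_bounded)
  fix x' :: "'a \<Rightarrow>\<^sub>L real"
  have "continuous_map weak_topology euclidean (blinfun_apply x')"
    unfolding continuous_map_def using openin_weak_vimage[of _ x'] by (auto simp: vimage_def)
  then have "compactin euclidean (blinfun_apply x' ` C)"
    using assms image_compactin[of weak_topology C] by (simp add: cwk_def del: compactin_euclidean_iff)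
  then show "bounded (blinfun_apply x' ` C)" by (simp add: compact_imp_bounded)
qed

lemma cwk_nonempty: "C \<in> cwk \<Longrightarrow> C \<noteq> {}" by (simp add: cwk_def)

section \<open>The Hausdorff distance\<close>

lemma bdd_above_infdist:
  assumes "bounded A" "B \<noteq> {}"
  shows "bdd_above ((\<lambda>a. infdist a B) ` A)"
proof -
  obtain b where b: "b \<in> B" using assms by auto
  obtain M where "\<forall>a\<in>A. dist b a \<le> M" using assms(1) bounded_any_center by blast
  then show ?thesis using infdist_le[OF b] by (intro bdd_aboveI2[where M=M]) (metis dist_commute order_trans)
qed

text \<open>
  Boundedness and non-emptiness guarantee that the real suprema in the definition of the distance
  are meaningful.
\<close>
lemma hausdorff_distance_le_iff:
  assumes "bounded A" "A \<noteq> {}" "bounded B" "B \<noteq> {}"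
  shows "hausdorff_distance A B \<le> c \<longleftrightarrow> (\<forall>a\<in>A. infdist a B \<le> c) \<and> (\<forall>b\<in>B. infdist b A \<le> c)"
  unfolding hausdorff_distance_def max.bounded_iff
  using assms by (simp add: cSUP_le_iff bdd_above_infdist)

lemma infdist_le_hausdorff_distance:
  assumes "bounded A" "B \<noteq> {}" "a \<in> A"
  shows "infdist a B \<le> hausdorff_distance A B"
  unfolding hausdorff_distance_def using cSUP_upper[OF assms(3) bdd_above_infdist[OF assms(1,2)]] by simp

lemma hausdorff_distance_commute: "hausdorff_distance A B = hausdorff_distance B A"
  by (simp add: hausdorff_distance_def max.commute)

lemma hausdorff_distance_nonneg:
  assumes "bounded A" "A \<noteq> {}" "B \<noteq> {}"
  shows "0 \<le> hausdorff_distance A B"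
proof -
  obtain a where "a \<in> A" using assms by auto
  then show ?thesis using infdist_le_hausdorff_distance[OF assms(1,3)] infdist_nonneg order_trans by blast
qed

lemma infdist_near:
  assumes "A \<noteq> {}" "e > 0"
  obtains a where "a \<in> A" "dist x a < infdist x A + e"
proof -
  have "(INF a\<in>A. dist x a) < infdist x A + e" using assms by (simp add: infdist_notempty)
  then show ?thesis using assms that by (auto simp: cINF_less_iff)
qed

lemma infdist_hausdorff_triangle:
  assumes "bounded B" "B \<noteq> {}" "C \<noteq> {}"
  shows "infdist a C \<le> infdist a B + hausdorff_distance B C"
proof (rule field_le_epsilon)
  fix e :: real assume "e > 0"
  then obtain b where b: "b \<in> B" "dist a b < infdist a B + e" using infdist_near assms by blast
  have "infdist a C \<le> infdist b C + dist a b" by (rule infdist_triangle)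
  also have "infdist b C \<le> hausdorff_distance B C" using assms b by (intro infdist_le_hausdorff_distance)
  finally show "infdist a C \<le> infdist a B + hausdorff_distance B C + e" using b by simp
qed

lemma hausdorff_distance_triangle:
  assumes "bounded A" "A \<noteq> {}" "bounded B" "B \<noteq> {}" "bounded C" "C \<noteq> {}"
  shows "hausdorff_distance A C \<le> hausdorff_distance A B + hausdorff_distance B C"
proof -
  have "infdist a C \<le> hausdorff_distance A B + hausdorff_distance B C" if "a \<in> A" for a
    using infdist_hausdorff_triangle[OF assms(3,4,6), of a]
          infdist_le_hausdorff_distance[OF assms(1,4) that] by linarith
  moreover have "infdist c A \<le> hausdorff_distance A B + hausdorff_distance B C" if "c \<in> C" for c
    using infdist_hausdorff_triangle[OF assms(3,4,2), of c]
          infdist_le_hausdorff_distance[OF assms(5,4) that] hausdorff_distance_commute[of A B]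
          hausdorff_distance_commute[of B C] by linarith
  ultimately show ?thesis using assms by (simp add: hausdorff_distance_le_iff)
qed

lemma infdist_scaleR:
  fixes x :: "'a::real_normed_vector"
  assumes "c > 0"
  shows "infdist (c *\<^sub>R x) ((*\<^sub>R) c ` A) = c * infdist x A"
proof (cases "A = {}")
  case False
  have le: "infdist (c *\<^sub>R x) ((*\<^sub>R) c ` A) \<le> c * infdist x A" if "c > 0" "A \<noteq> {}" for c and x :: 'a and A
  proof -
    have "infdist (c *\<^sub>R x) ((*\<^sub>R) c ` A) / c \<le> infdist x A"
      unfolding infdist_notempty[OF that(2)]
    proof (rule cINF_greatest[OF that(2)])
      fix a assume "a \<in> A"
      then have "infdist (c *\<^sub>R x) ((*\<^sub>R) c ` A) \<le> dist (c *\<^sub>R x) (c *\<^sub>R a)" by (intro infdist_le imageI)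
      also have "\<dots> = c * dist x a"
        using that by (simp add: dist_norm scaleR_diff_right[symmetric])
      finally show "infdist (c *\<^sub>R x) ((*\<^sub>R) c ` A) / c \<le> dist x a"
        using that by (simp add: field_simps)
    qed
    then show ?thesis using that by (simp add: field_simps)
  qed
  have "infdist ((1/c) *\<^sub>R c *\<^sub>R x) ((*\<^sub>R) (1/c) ` (*\<^sub>R) c ` A) \<le> (1/c) * infdist (c *\<^sub>R x) ((*\<^sub>R) c ` A)"
    by (rule le) (use assms False in auto)
  then show ?thesis using le[OF assms False, of x] assms by (simp add: image_image field_simps)
qed (simp add: infdist_def)

text \<open>
  Divides an estimate for a primitive by the length \<open>c\<close> of the interval, so that it becomes an
  estimate for the difference quotient.
\<close>
lemma hausdorff_distance_scaleR_le:
  fixes A B :: "'a::real_normed_vector set"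
  assumes "bounded A" "A \<noteq> {}" "bounded B" "B \<noteq> {}" "c > 0"
    and "hausdorff_distance A ((*\<^sub>R) c ` B) \<le> c * e"
  shows "hausdorff_distance ((*\<^sub>R) (1/c) ` A) B \<le> e"
proof -
  have A: "A = (*\<^sub>R) c ` (*\<^sub>R) (1/c) ` A" using assms(5) by (simp add: image_image)
  have "bounded ((*\<^sub>R) c ` B)" by (rule bounded_scaling[OF assms(3)])
  moreover have b2: "bounded ((*\<^sub>R) (1/c) ` A)" by (rule bounded_scaling[OF assms(1)])
  ultimately have *: "\<forall>a\<in>A. infdist a ((*\<^sub>R) c ` B) \<le> c * e" "\<forall>b\<in>B. infdist (c *\<^sub>R b) A \<le> c * e"
    using assms by (auto simp: hausdorff_distance_le_iff)
  have "infdist ((1/c) *\<^sub>R a) B \<le> e" if "a \<in> A" for a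
    using *(1) that infdist_scaleR[OF assms(5), of "(1/c) *\<^sub>R a" B] assms(5) by auto
  moreover have "infdist b ((*\<^sub>R) (1/c) ` A) \<le> e" if "b \<in> B" for b
    using *(2) that infdist_scaleR[OF assms(5), of b "(*\<^sub>R) (1/c) ` A"] assms(5) A by auto
  ultimately show ?thesis
    unfolding hausdorff_distance_le_iff[OF b2 _ assms(3,4)] using assms(2)
    by (subst hausdorff_distance_le_iff[OF b2 _ assms(3,4)]) simp_all
qed

section \<open>Fine partitions of an interval\<close>

text \<open>
  Perron partitions of an arbitrary interval, so that partitions of adjacent intervals can be joined.
\<close>
definition perron_on :: "real \<Rightarrow> real \<Rightarrow> (real set \<times> real) set \<Rightarrow> bool" where
  "perron_on a b P \<longleftrightarrow>
     finite P \<and>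
     (\<forall>(I, t)\<in>P. t \<in> I \<and> (\<exists>c d. I = {c..d} \<and> c < d)) \<and>
     pairwise (\<lambda>p q. nonoverlapping (fst p) (fst q)) P \<and>
     (\<Union>(I, t)\<in>P. I) = {a..b}"

lemma perron_on_subset:
  assumes "perron_on a b P" "p \<in> P" shows "fst p \<subseteq> {a..b}"
proof -
  have "fst p \<subseteq> (\<Union>(I, t)\<in>P. I)" using assms(2) by (cases p) auto
  then show ?thesis using assms(1) by (simp add: perron_on_def)
qed

lemma perron_onE:
  assumes "perron_on a b P" "(I, t) \<in> P"
  obtains c d where "I = {c..d}" "c < d" "a \<le> c" "d \<le> b" "t \<in> I"
proof -
  obtain c d where I: "I = {c..d}" "c < d" "t \<in> I" using assms by (fastforce simp: perron_on_def)
  have "{c..d} \<subseteq> {a..b}" using perron_on_subset[OF assms] I by simp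
  then show ?thesis using that[OF I(1,2)] I by auto
qed

lemma perron_on_single: "a < b \<Longrightarrow> t \<in> {a..b} \<Longrightarrow> perron_on a b {({a..b}, t)}"
  by (auto simp: perron_on_def)

lemma perron_on_union:
  assumes P: "perron_on a b P" and Q: "perron_on b c Q" and ab: "a \<le> b" "b \<le> c"
  shows "perron_on a c (P \<union> Q)" and "P \<inter> Q = {}"
proof -
  have ends: "fst p \<subseteq> {a..b}" "fst q \<subseteq> {b..c}" if "p \<in> P" "q \<in> Q" for p q
    using perron_on_subset[OF P that(1)] perron_on_subset[OF Q that(2)] by simp_all
  have no: "nonoverlapping (fst p) (fst q)" if "p \<in> P" "q \<in> Q" for p q
  proof -
    have "interior (fst p) \<inter> interior (fst q) \<subseteq> interior {a..b} \<inter> interior {b..c}"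
      using ends[OF that] by (intro Int_mono interior_mono)
    also have "\<dots> = {}" by auto
    finally show ?thesis by (simp add: nonoverlapping_def)
  qed
  then have no': "nonoverlapping (fst q) (fst p)" if "p \<in> P" "q \<in> Q" for p q
    using that by (metis nonoverlapping_def inf_commute)
  have "{a..b} \<union> {b..c} = {a..c}" using ab by auto
  moreover have "pairwise (\<lambda>p q. nonoverlapping (fst p) (fst q)) (P \<union> Q)"
    using P Q no no' by (auto simp: pairwise_def perron_on_def)
  ultimately show "perron_on a c (P \<union> Q)"
    using P Q unfolding perron_on_def by (simp add: ball_Un)
  show "P \<inter> Q = {}"
  proof (rule ccontr)
    assume "P \<inter> Q \<noteq> {}"
    then obtain I t where It: "(I, t) \<in> P" "(I, t) \<in> Q" by (metis disjoint_iff surj_pair)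
    obtain c d where "I = {c..d}" "c < d" using perron_onE[OF P It(1)] by metis
    then show False using no[OF It] by (simp add: nonoverlapping_def)
  qed
qed

lemma gauge_fine_union: "gauge_fine \<delta> P \<Longrightarrow> gauge_fine \<delta> Q \<Longrightarrow> gauge_fine \<delta> (P \<union> Q)"
  by (auto simp: gauge_fine_def)

lemma perron_on_unit: "perron_on 0 1 P \<Longrightarrow> perron_partition P"
proof -
  assume P: "perron_on 0 1 P"
  have "I \<in> subintervals \<and> t \<in> {0..1} \<and> t \<in> I" if It: "(I, t) \<in> P" for I t
  proof -
    obtain c d where "I = {c..d}" "c < d" "0 \<le> c" "d \<le> 1" "t \<in> I" using perron_onE[OF P It] by metis
    then show ?thesis unfolding subintervals_def by auto
  qed
  then show ?thesis
    using P unfolding perron_partition_def tagged_partition_def perron_on_def by blast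
qed

text \<open>
  Cousin's lemma.
\<close>
lemma exists_fine_perron_on:
  assumes "a < b" and \<delta>: "\<And>t. t \<in> {a..b} \<Longrightarrow> \<delta> t > 0"
  obtains P where "perron_on a b P" "gauge_fine \<delta> P"
proof -
  define S where "S c d \<longleftrightarrow> a \<le> c \<and> c < d \<and> d \<le> b \<longrightarrow> (\<exists>P. perron_on c d P \<and> gauge_fine \<delta> P)" for c d
  have "a \<le> b" using assms by simp
  then have "S a b"
  proof (induction rule: Bolzano)
    case (trans c d e)
    show ?case
    proof (cases "c < d \<and> d < e")
      case True
      show ?thesis unfolding S_def
      proof
        assume "a \<le> c \<and> c < e \<and> e \<le> b"
        then obtain P Q where "perron_on c d P" "gauge_fine \<delta> P" "perron_on d e Q" "gauge_fine \<delta> Q"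
          using trans True unfolding S_def by fastforce
        then show "\<exists>P. perron_on c e P \<and> gauge_fine \<delta> P"
          using perron_on_union(1)[of c d P e Q] gauge_fine_union[of \<delta> P Q] True by fastforce
      qed
    next
      case False
      then have "c = d \<or> d = e" using trans by linarith
      then show ?thesis using trans by auto
    qed
  next
    case (local x)
    show ?case
    proof (intro exI[of _ "\<delta> x"] conjI allI impI)
      show "\<delta> x > 0" using \<delta> local by simp
      fix c d assume cd: "c \<le> x \<and> x \<le> d \<and> d - c < \<delta> x"
      show "S c d" unfolding S_def
      proof
        assume "a \<le> c \<and> c < d \<and> d \<le> b"
        then have "perron_on c d {({c..d}, x)}" "gauge_fine \<delta> {({c..d}, x)}"
          using cd by (auto simp: gauge_fine_def intro!: perron_on_single)
        then show "\<exists>P. perron_on c d P \<and> gauge_fine \<delta> P" by blast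
      qed
    qed
  qed
  then show ?thesis using that assms by (auto simp: S_def)
qed

section \<open>Dyadic cells and variation\<close>

definition dyadic :: "nat \<Rightarrow> int \<Rightarrow> real set" where
  "dyadic n j = {real_of_int j / 2 ^ n .. (real_of_int j + 1) / 2 ^ n}"

abbreviation dyadic_index :: "nat \<Rightarrow> real \<Rightarrow> int" where
  "dyadic_index n t \<equiv> \<lfloor>2 ^ n * t\<rfloor>"

lemma in_dyadic: "t \<in> dyadic n (dyadic_index n t)"
  unfolding dyadic_def by (simp add: field_simps)  linarith

lemma dyadic_index_Suc:
  "dyadic_index (Suc n) t = 2 * dyadic_index n t \<or> dyadic_index (Suc n) t = 2 * dyadic_index n t + 1"
proof -
  define x where "x = 2 ^ n * t"
  have "dyadic_index (Suc n) t = \<lfloor>2 * x\<rfloor>" by (simp add: x_def mult.assoc)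
  moreover have "\<lfloor>2 * x\<rfloor> = 2 * \<lfloor>x\<rfloor> \<or> \<lfloor>2 * x\<rfloor> = 2 * \<lfloor>x\<rfloor> + 1" by linarith
  ultimately show ?thesis by (simp only: x_def)
qed

lemma measure_dyadic: "measure lborel (dyadic n j) = 1 / 2 ^ n"
  unfolding dyadic_def by (simp add: divide_right_mono field_simps)

lemma dyadic_in_subintervals:
  assumes "0 \<le> j" "j < 2 ^ n" shows "dyadic n j \<in> subintervals"
proof -
  have "j + 1 \<le> 2 ^ n" using assms by simp
  then have "real_of_int (j + 1) \<le> real_of_int (2 ^ n)" by (rule of_int_le_iff[THEN iffD2])
  then have "real_of_int j + 1 \<le> 2 ^ n" by simp
  then show ?thesis
    using assms unfolding subintervals_def dyadic_def
    by (intro CollectI exI[of _ "real_of_int j / 2 ^ n"] exI[of _ "(real_of_int j + 1) / 2 ^ n"])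
       (simp add: divide_strict_right_mono)
qed

lemma dyadic_index_range:
  assumes "0 \<le> t" "t < 1" shows "0 \<le> dyadic_index n t" "dyadic_index n t < 2 ^ n"
proof -
  show "0 \<le> dyadic_index n t" using assms by simp
  have "2 ^ n * t < 2 ^ n" using assms by simp
  then show "dyadic_index n t < 2 ^ n" by (simp add: floor_less_iff)
qed

text \<open>
  Cells marked by \<open>B\<close> are collected by descending at most \<open>m\<close> levels below the cell \<open>dyadic n j\<close> and
  stopping at the first marked cell on each branch. The cells collected do not overlap, and together
  they cover every marked cell met within these levels.
\<close>
fun marked_union :: "(nat \<Rightarrow> int \<Rightarrow> bool) \<Rightarrow> nat \<Rightarrow> nat \<Rightarrow> int \<Rightarrow> real set" where
  "marked_union B 0 n j = (if B n j then dyadic n j else {})"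
| "marked_union B (Suc m) n j = (if B n j then dyadic n j
     else marked_union B m (Suc n) (2 * j) \<union> marked_union B m (Suc n) (2 * j + 1))"

lemma compact_marked_union: "compact (marked_union B m n j)"
  by (induction m arbitrary: n j) (auto simp: dyadic_def)

lemma marked_union_mono: "marked_union B m n j \<subseteq> marked_union B (Suc m) n j"
proof (induction m arbitrary: n j)
  case (Suc m)
  show ?case
    using Suc[of "Suc n" "2 * j"] Suc[of "Suc n" "2 * j + 1"]
    by (subst (1 2) marked_union.simps(2)) auto
qed simp

lemma marked_unionI:
  assumes "B (n + k) (dyadic_index (n + k) t)" "k \<le> m"
  shows "t \<in> marked_union B m n (dyadic_index n t)"
  using assms
proof (induction m arbitrary: n k)
  case 0
  then show ?case using in_dyadic by simp
next
  case (Suc m)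
  show ?case
  proof (cases "B n (dyadic_index n t)")
    case True then show ?thesis using in_dyadic by simp
  next
    case False
    with Suc.prems obtain k' where k: "k = Suc k'" by (cases k) auto
    have "t \<in> marked_union B m (Suc n) (dyadic_index (Suc n) t)"
      by (rule Suc.IH[of _ k']) (use Suc.prems k in \<open>auto simp del: power_Suc\<close>)
    then show ?thesis using False dyadic_index_Suc[of n t] by (auto simp del: power_Suc)
  qed
qed

text \<open>
  If each marked cell carries a tag that makes it fine and contributes at least \<open>c\<close> times its
  length, then the cells collected by \<open>marked_union\<close> occur together in a single fine partition. The
  partition is assembled along the recursion: a marked cell is taken as it is, an unmarked one is
  halved, and Cousin's lemma fills the cells at which the recursion ends. Applied to a partition with
  sum less than \<open>\<epsilon>\<close>, the estimate bounds the measure of the union by \<open>\<epsilon> / c\<close>.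
\<close>
lemma partition_through_marked_cells:
  fixes h :: "real set \<Rightarrow> real \<Rightarrow> real"
  assumes \<delta>: "\<And>t. t \<in> {0..1} \<Longrightarrow> \<delta> t > 0"
    and h: "\<And>I t. I \<in> subintervals \<Longrightarrow> t \<in> {0..1} \<Longrightarrow> 0 \<le> h I t"
    and B: "\<And>n j. B n j \<Longrightarrow>
        \<exists>t\<in>dyadic n j. dyadic n j \<subseteq> {t - \<delta> t <..< t + \<delta> t} \<and> c / 2 ^ n \<le> h (dyadic n j) t"
    and c: "c > 0" and j: "0 \<le> j" "j < 2 ^ n"
  obtains P where "perron_on (real_of_int j / 2 ^ n) ((real_of_int j + 1) / 2 ^ n) P" "gauge_fine \<delta> P"
    "c * measure lborel (marked_union B m n j) \<le> (\<Sum>(I, t)\<in>P. h I t)"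
proof -
  have marked: "\<exists>P. perron_on (real_of_int j / 2 ^ n) ((real_of_int j + 1) / 2 ^ n) P \<and> gauge_fine \<delta> P
    \<and> c * measure lborel (dyadic n j) \<le> (\<Sum>(I, t)\<in>P. h I t)" if Bnj: "B n j" for n j
  proof -
    obtain t where t: "t \<in> dyadic n j" "dyadic n j \<subseteq> {t - \<delta> t <..< t + \<delta> t}" "c / 2 ^ n \<le> h (dyadic n j) t"
      using B[OF Bnj] by blast
    have "perron_on (real_of_int j / 2 ^ n) ((real_of_int j + 1) / 2 ^ n) {(dyadic n j, t)}"
      unfolding dyadic_def by (rule perron_on_single) (use t in \<open>auto simp: dyadic_def divide_strict_right_mono\<close>)
    then show ?thesis using t
      by (intro exI[of _ "{(dyadic n j, t)}"]) (simp add: gauge_fine_def measure_dyadic)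
  qed
  have "\<exists>P. perron_on (real_of_int j / 2 ^ n) ((real_of_int j + 1) / 2 ^ n) P \<and> gauge_fine \<delta> P
    \<and> c * measure lborel (marked_union B m n j) \<le> (\<Sum>(I, t)\<in>P. h I t)"
    using j
  proof (induction m arbitrary: n j)
    case (0 n j)
    show ?case
    proof (cases "B n j")
      case True then show ?thesis using marked by simp
    next
      case False
      have sub: "{real_of_int j / 2 ^ n..(real_of_int j + 1) / 2 ^ n} \<subseteq> {0..1}"
        using dyadic_in_subintervals[OF 0] unfolding dyadic_def subintervals_def by auto
      obtain P where P: "perron_on (real_of_int j / 2 ^ n) ((real_of_int j + 1) / 2 ^ n) P" "gauge_fine \<delta> P"
        by (rule exists_fine_perron_on[of "real_of_int j / 2 ^ n" "(real_of_int j + 1) / 2 ^ n" \<delta>])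
           (simp add: divide_strict_right_mono, rule \<delta>, use sub in blast)
      have "0 \<le> (\<Sum>(I, t)\<in>P. h I t)"
      proof (rule sum_nonneg, clarify)
        fix I t assume "(I, t) \<in> P"
        then obtain c d where cd: "I = {c..d}" "c < d" "t \<in> I"
          using perron_onE[OF P(1)] by metis
        have "fst (I, t) \<subseteq> {0..1}"
          by (rule subset_trans[OF perron_on_subset[OF P(1) \<open>(I, t) \<in> P\<close>] sub])
        then have "I \<subseteq> {0..1}" by (simp only: fst_conv)
        moreover have "c \<in> I" "d \<in> I" using cd by simp_all
        ultimately have "0 \<le> c" "d \<le> 1" "t \<in> {0..1}" using cd(3) by auto
        then show "0 \<le> h I t" using cd by (intro h) (auto simp: subintervals_def)
      qed
      then show ?thesis using P False by auto
    qed
  next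
    case (Suc m n j)
    show ?case
    proof (cases "B n j")
      case True then show ?thesis using marked by simp
    next
      case False
      let ?l = "real_of_int j / 2 ^ n" and ?r = "(real_of_int j + 1) / 2 ^ n"
      let ?m = "real_of_int (2 * j + 1) / 2 ^ Suc n"
      have ends: "real_of_int (2 * j) / 2 ^ Suc n = ?l" "(real_of_int (2 * j) + 1) / 2 ^ Suc n = ?m"
        "(real_of_int (2 * j + 1) + 1) / 2 ^ Suc n = ?r"
        by (simp_all add: field_simps)
      have ord: "?l \<le> ?m" "?m \<le> ?r" by (simp_all add: field_simps)
      obtain P where P: "perron_on ?l ?m P" "gauge_fine \<delta> P"
        "c * measure lborel (marked_union B m (Suc n) (2 * j)) \<le> (\<Sum>(I, t)\<in>P. h I t)"
        using Suc.IH[of "2 * j" "Suc n"] Suc.prems unfolding ends by auto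
      obtain Q where Q: "perron_on ?m ?r Q" "gauge_fine \<delta> Q"
        "c * measure lborel (marked_union B m (Suc n) (2 * j + 1)) \<le> (\<Sum>(I, t)\<in>Q. h I t)"
        using Suc.IH[of "2 * j + 1" "Suc n"] Suc.prems unfolding ends by auto
      have "measure lborel (marked_union B (Suc m) n j)
          \<le> measure lborel (marked_union B m (Suc n) (2 * j)) + measure lborel (marked_union B m (Suc n) (2 * j + 1))"
        using False by (auto intro!: measure_Un_le borel_compact compact_marked_union)
      then have "c * measure lborel (marked_union B (Suc m) n j)
          \<le> c * measure lborel (marked_union B m (Suc n) (2 * j)) + c * measure lborel (marked_union B m (Suc n) (2 * j + 1))"
        using c by (metis distrib_left mult_le_cancel_left_pos)
      also have "\<dots> \<le> (\<Sum>(I, t)\<in>P. h I t) + (\<Sum>(I, t)\<in>Q. h I t)" using P Q by simp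
      also have "\<dots> = (\<Sum>(I, t)\<in>P \<union> Q. h I t)"
        using P Q perron_on_union(2)[OF P(1) Q(1) ord]
        by (intro sum.union_disjoint[symmetric]) (auto simp: perron_on_def)
      finally show ?thesis
        using perron_on_union(1)[OF P(1) Q(1) ord] gauge_fine_union[OF P(2) Q(2)] by blast
    qed
  qed
  then show ?thesis using that by blast
qed

text \<open>
  Given a gauge for a small sum, mark the cells that are fine for some tag with a large contribution.
  If \<open>t\<close> has infinitely many cells with a large contribution, then some of them are shorter than
  the gauge at \<open>t\<close>, hence marked. So the set in question lies in a union of marked cells, whose
  measure is as small as desired.
\<close>
lemma variation_on_cells_null:
  fixes h :: "real set \<Rightarrow> real \<Rightarrow> real"
  assumes h: "\<And>I t. I \<in> subintervals \<Longrightarrow> t \<in> {0..1} \<Longrightarrow> 0 \<le> h I t"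
    and var: "\<And>\<epsilon>. \<epsilon> > 0 \<Longrightarrow> \<exists>\<delta>. (\<forall>t\<in>{0..1}. \<delta> t > 0) \<and>
        (\<forall>P. perron_partition P \<and> gauge_fine \<delta> P \<longrightarrow> (\<Sum>(I, t)\<in>P. h I t) < \<epsilon>)"
    and c: "c > 0"
  shows "negligible {t\<in>{0..<1}. \<exists>\<^sub>F n in sequentially. c / 2 ^ n \<le> h (dyadic n (dyadic_index n t)) t}"
    (is "negligible ?N")
  unfolding negligible_outer
proof (intro allI impI)
  fix e :: real assume e: "e > 0"
  \<comment> \<open>The marked cells then cover a set of measure at most \<open>\<epsilon> / c = e / 2\<close>.\<close>
  define \<epsilon> where "\<epsilon> = c * e / 2"
  have "\<epsilon> > 0" using c e by (simp add: \<epsilon>_def)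
  then obtain \<delta> where \<delta>: "\<And>t. t \<in> {0..1} \<Longrightarrow> \<delta> t > 0"
    and small: "\<And>P. perron_partition P \<Longrightarrow> gauge_fine \<delta> P \<Longrightarrow> (\<Sum>(I, t)\<in>P. h I t) < \<epsilon>"
    using var by (metis (no_types, lifting))
  define B where "B n j \<longleftrightarrow> (\<exists>t\<in>dyadic n j. dyadic n j \<subseteq> {t - \<delta> t <..< t + \<delta> t} \<and> c / 2 ^ n \<le> h (dyadic n j) t)"
    for n j
  define W where "W m = marked_union B m 0 0" for m
  have W_le: "measure lborel (W m) \<le> e / 2" for m
  proof -
    obtain P where P: "perron_on (real_of_int 0 / 2 ^ 0) ((real_of_int 0 + 1) / 2 ^ 0) P" "gauge_fine \<delta> P"
      and *: "c * measure lborel (W m) \<le> (\<Sum>(I, t)\<in>P. h I t)"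
      unfolding W_def
      by (rule partition_through_marked_cells[where B=B and \<delta>=\<delta> and h=h and c=c and j=0 and n=0 and m=m])
         (use \<delta> h c in \<open>auto simp: B_def\<close>)
    have "(\<Sum>(I, t)\<in>P. h I t) < \<epsilon>" using P by (intro small perron_on_unit) simp_all
    with * have "c * measure lborel (W m) \<le> c * (e / 2)" by (simp add: \<epsilon>_def)
    then show ?thesis using c by simp
  qed
  have inc: "incseq W" unfolding W_def by (intro incseq_SucI marked_union_mono)
  have W_sets: "W m \<in> fmeasurable lborel" for m
    unfolding W_def by (intro fmeasurable_compact compact_marked_union)
  have W_em: "emeasure lborel (W m) \<le> ennreal (e / 2)" for m
    using W_le[of m] W_sets[of m] by (simp add: emeasure_eq_measure2 ennreal_leI)
  have "range W \<subseteq> sets lborel" using W_sets by (auto simp: fmeasurable_def)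
  then have "emeasure lborel (\<Union>m. W m) = (SUP m. emeasure lborel (W m))"
    using inc by (intro SUP_emeasure_incseq[symmetric])
  also have "\<dots> \<le> ennreal (e / 2)" using W_em by (intro SUP_least)
  finally have em: "emeasure lborel (\<Union>m. W m) \<le> ennreal (e / 2)" .
  have sets: "(\<Union>m. W m) \<in> sets lborel" using W_sets by (auto simp: fmeasurable_def)
  have em': "emeasure lebesgue (\<Union>m. W m) \<le> ennreal (e / 2)" using em sets by simp
  have lm: "(\<Union>m. W m) \<in> lmeasurable"
    using em' sets by (intro fmeasurableI) (auto intro: le_less_trans)
  have "ennreal (measure lebesgue (\<Union>m. W m)) \<le> ennreal (e / 2)"
    using em' lm by (simp add: emeasure_eq_measure2)
  then have "measure lebesgue (\<Union>m. W m) \<le> e / 2" using e by (simp add: ennreal_le_iff)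
  then have "measure lebesgue (\<Union>m. W m) < e" using e by simp
  moreover have "?N \<subseteq> (\<Union>m. W m)"
  proof
    fix t assume t: "t \<in> ?N"
    then have t01: "t \<in> {0..<1}" by simp
    have dt: "\<delta> t > 0" using \<delta> t01 by simp
    have "(\<lambda>n. (1/2::real) ^ n) \<longlonglongrightarrow> 0" by (rule LIMSEQ_realpow_zero) auto
    then have ev: "\<forall>\<^sub>F n in sequentially. (1/2::real) ^ n < \<delta> t" using dt by (rule order_tendstoD(2))
    have "\<exists>\<^sub>F n in sequentially. c / 2 ^ n \<le> h (dyadic n (dyadic_index n t)) t" using t by blast
    then have "\<exists>\<^sub>F n in sequentially. (1/2::real) ^ n < \<delta> t \<and> c / 2 ^ n \<le> h (dyadic n (dyadic_index n t)) t"
      using ev by (rule frequently_eventually_conj)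
    then obtain n where n: "c / 2 ^ n \<le> h (dyadic n (dyadic_index n t)) t" "(1/2::real) ^ n < \<delta> t"
      by (auto dest: frequently_ex)
    have n2: "1 / 2 ^ n < \<delta> t" using n(2) by (simp add: power_one_over)
    have "dyadic n (dyadic_index n t) \<subseteq> {t - \<delta> t <..< t + \<delta> t}"
    proof
      fix s assume "s \<in> dyadic n (dyadic_index n t)"
      then have "\<bar>s - t\<bar> \<le> 1 / 2 ^ n"
        using in_dyadic[of t n] unfolding dyadic_def atLeastAtMost_iff add_divide_distrib by linarith
      then show "s \<in> {t - \<delta> t <..< t + \<delta> t}" using n2 by auto
    qed
    then have "B (0 + n) (dyadic_index (0 + n) t)" using n in_dyadic[of t n] by (auto simp: B_def)
    then have "t \<in> marked_union B n 0 (dyadic_index 0 t)" by (rule marked_unionI) simp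
    moreover have "dyadic_index 0 t = 0" using t01 by (simp add: floor_eq_iff)
    ultimately show "t \<in> (\<Union>m. W m)" by (auto simp: W_def)
  qed
  ultimately show "\<exists>T. ?N \<subseteq> T \<and> T \<in> lmeasurable \<and> measure lebesgue T < e" using lm by blast
qed

lemma variation_on_cells_tendsto_zero:
  fixes h :: "real set \<Rightarrow> real \<Rightarrow> real"
  assumes h: "\<And>I t. I \<in> subintervals \<Longrightarrow> t \<in> {0..1} \<Longrightarrow> 0 \<le> h I t"
    and var: "\<And>\<epsilon>. \<epsilon> > 0 \<Longrightarrow> \<exists>\<delta>. (\<forall>t\<in>{0..1}. \<delta> t > 0) \<and>
        (\<forall>P. perron_partition P \<and> gauge_fine \<delta> P \<longrightarrow> (\<Sum>(I, t)\<in>P. h I t) < \<epsilon>)"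
  obtains N where "negligible N"
    "\<And>t. t \<in> {0..<1} - N \<Longrightarrow> (\<lambda>n. 2 ^ n * h (dyadic n (dyadic_index n t)) t) \<longlonglongrightarrow> 0"
proof
  define M where "M k = {t\<in>{0..<1}. \<exists>\<^sub>F n in sequentially. (1 / real (Suc k)) / 2 ^ n \<le> h (dyadic n (dyadic_index n t)) t}" for k
  show "negligible (\<Union>k. M k)"
    unfolding M_def by (intro negligible_Union_nat allI variation_on_cells_null assms) auto
  fix t :: real assume t: "t \<in> {0..<1} - (\<Union>k. M k)"
  show "(\<lambda>n. 2 ^ n * h (dyadic n (dyadic_index n t)) t) \<longlonglongrightarrow> 0"
  proof (rule tendstoI)
    fix e :: real assume "e > 0"
    then obtain k where k: "1 / real (Suc k) < e" using nat_approx_posE by blast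
    have "\<forall>\<^sub>F n in sequentially. \<not> (1 / real (Suc k)) / 2 ^ n \<le> h (dyadic n (dyadic_index n t)) t"
      using t by (auto simp: M_def frequently_def)
    then show "\<forall>\<^sub>F n in sequentially. dist (2 ^ n * h (dyadic n (dyadic_index n t)) t) 0 < e"
    proof eventually_elim
      case (elim n)
      have "0 \<le> h (dyadic n (dyadic_index n t)) t"
        using t by (intro h dyadic_in_subintervals dyadic_index_range) auto
      moreover have "h (dyadic n (dyadic_index n t)) t < 1 / real (Suc k) / 2 ^ n"
        using elim by (simp only: not_le)
      then have "2 ^ n * h (dyadic n (dyadic_index n t)) t < 1 / real (Suc k)"
        by (simp only: pos_less_divide_eq zero_less_power zero_less_numeral mult.commute)
      ultimately show ?case using k by simp
    qed
  qed
qed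

section \<open>Uniformly approximable functions are variationally McShane integrable\<close>

text \<open>
  Approximation in mean, with the upper integral of the error measured by a real majorant \<open>h\<close>. The
  integral of \<open>h\<close> controls the difference of the Riemann sums of \<open>f\<close> and of \<open>g\<close>, so the Cauchy criterion
  passes from \<open>g\<close> to \<open>f\<close>.
\<close>
lemma integrable_if_integrably_approximable:
  fixes f :: "'n::euclidean_space \<Rightarrow> 'b::banach"
  assumes approx: "\<And>e. e > 0 \<Longrightarrow> \<exists>g h. g integrable_on cbox a b \<and> h integrable_on cbox a b \<and>
      (\<forall>x\<in>cbox a b. norm (f x - g x) \<le> h x) \<and> integral (cbox a b) h < e"
  shows "f integrable_on cbox a b"
  unfolding integrable_Cauchy
proof (intro allI impI)
  fix e :: real assume e: "e > 0"
  then have e6: "e / 6 > 0" by simp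
  obtain g and h :: "'n \<Rightarrow> real" where g: "g integrable_on cbox a b" and h: "h integrable_on cbox a b"
    and le: "\<And>x. x \<in> cbox a b \<Longrightarrow> norm (f x - g x) \<le> h x" and small: "integral (cbox a b) h < e / 6"
    using approx[OF e6] by blast
  obtain \<gamma>1 where \<gamma>1: "gauge \<gamma>1" and g1: "\<forall>p q. p tagged_division_of cbox a b \<and> \<gamma>1 fine p \<and>
      q tagged_division_of cbox a b \<and> \<gamma>1 fine q \<longrightarrow>
      norm ((\<Sum>(x,K)\<in>p. measure lborel K *\<^sub>R g x) - (\<Sum>(x,K)\<in>q. measure lborel K *\<^sub>R g x)) < e / 6"
    using g[unfolded integrable_Cauchy, THEN spec, THEN mp, OF e6] by (elim exE conjE) (rule that)
  obtain \<gamma>2 where \<gamma>2: "gauge \<gamma>2" and h2: "\<forall>p. p tagged_division_of cbox a b \<and> \<gamma>2 fine p \<longrightarrow>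
      norm ((\<Sum>(x,K)\<in>p. measure lborel K *\<^sub>R h x) - integral (cbox a b) h) < e / 6"
    using integrable_integral[OF h, unfolded has_integral, THEN spec, THEN mp, OF e6]
    by (elim exE conjE) (rule that)
  have sum_le: "norm ((\<Sum>(x,K)\<in>p. measure lborel K *\<^sub>R f x) - (\<Sum>(x,K)\<in>p. measure lborel K *\<^sub>R g x)) < e / 3"
    if p: "p tagged_division_of cbox a b" "\<gamma>2 fine p" for p
  proof -
    have "(\<Sum>(x,K)\<in>p. measure lborel K *\<^sub>R f x) - (\<Sum>(x,K)\<in>p. measure lborel K *\<^sub>R g x)
        = (\<Sum>(x,K)\<in>p. measure lborel K *\<^sub>R (f x - g x))"
      by (simp add: sum_subtractf[symmetric] split_beta scaleR_diff_right)
    also have "norm \<dots> \<le> (\<Sum>(x,K)\<in>p. measure lborel K *\<^sub>R h x)"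
    proof (rule sum_norm_le, clarify)
      fix x K assume xK: "(x, K) \<in> p"
      have "x \<in> cbox a b" using tagged_division_ofD(2,3)[OF p(1) xK] by blast
      then show "norm (measure lborel K *\<^sub>R (f x - g x)) \<le> measure lborel K *\<^sub>R h x"
        using le by (simp add: mult_left_mono)
    qed
    also have "\<dots> < e / 3" using h2[THEN spec, THEN mp, OF conjI[OF p]] small unfolding real_norm_def by linarith
    finally show ?thesis .
  qed
  show "\<exists>\<gamma>. gauge \<gamma> \<and> (\<forall>p q. p tagged_division_of cbox a b \<and> \<gamma> fine p \<and>
      q tagged_division_of cbox a b \<and> \<gamma> fine q \<longrightarrow>
      norm ((\<Sum>(x,K)\<in>p. measure lborel K *\<^sub>R f x) - (\<Sum>(x,K)\<in>q. measure lborel K *\<^sub>R f x)) < e)"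
  proof (intro exI[of _ "\<lambda>x. \<gamma>1 x \<inter> \<gamma>2 x"] conjI allI impI, goal_cases)
    case 1 show ?case using \<gamma>1 \<gamma>2 by (rule gauge_Int)
  next
    case (2 p q)
    let ?S = "\<lambda>f p. \<Sum>(x,K)\<in>p. measure lborel K *\<^sub>R f x"
    have "norm (?S f p - ?S g p) < e / 3" "norm (?S f q - ?S g q) < e / 3" "norm (?S g p - ?S g q) < e / 6"
      using 2 sum_le[of p] sum_le[of q] g1[THEN spec, THEN spec, of p q] unfolding fine_Int by simp_all
    moreover have "norm (?S f p - ?S f q) \<le> norm (?S f p - ?S g p) + norm (?S g p - ?S g q) + norm (?S f q - ?S g q)"
      using norm_triangle_ineq4[of "?S f p - ?S g p + (?S g p - ?S g q)" "?S f q - ?S g q"]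
        norm_triangle_ineq[of "?S f p - ?S g p" "?S g p - ?S g q"] by simp
    ultimately show ?case using e by linarith
  qed
qed

text \<open>
  On the unit interval \<open>g\<close> is a finite combination of indicators of dyadic cells. The index \<open>2 ^ n\<close>
  accounts for the right end point.
\<close>
lemma dyadic_step_integrable:
  fixes g :: "real \<Rightarrow> 'a::banach"
  assumes "\<And>s t. dyadic_index n s = dyadic_index n t \<Longrightarrow> g s = g t"
  shows "g integrable_on {0..1}"
proof -
  let ?C = "\<lambda>j. {t. dyadic_index n t = j}"
  have C: "?C j = {real_of_int j / 2 ^ n ..< (real_of_int j + 1) / 2 ^ n}" for j
    by (auto simp: floor_eq_iff field_simps)
  have "(\<lambda>t. \<Sum>j\<in>{0..2 ^ n}. indicat_real (?C j) t *\<^sub>R g (real_of_int j / 2 ^ n)) integrable_on {0..1}"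
  proof (intro integrable_sum integrable_on_scaleR_left)
    fix j :: int
    show "indicat_real (?C j) integrable_on {0..1}"
      unfolding integrable_on_indicator C
      by (intro fmeasurable.Int bounded_set_imp_lmeasurable) auto
  qed auto
  then show ?thesis
  proof (rule integrable_eq)
    fix t :: real assume t: "t \<in> {0..1}"
    then have "2 ^ n * t \<le> 2 ^ n" by simp
    then have "real_of_int (dyadic_index n t) \<le> real_of_int (2 ^ n)"
      using of_int_floor_le[of "2 ^ n * t"] unfolding of_int_power of_int_numeral by linarith
    then have "dyadic_index n t \<le> 2 ^ n" by (simp only: of_int_le_iff)
    then have j: "dyadic_index n t \<in> {0..2 ^ n}" using t by simp
    have "(\<Sum>j\<in>{0..2 ^ n}. indicat_real (?C j) t *\<^sub>R g (real_of_int j / 2 ^ n))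
        = (\<Sum>j\<in>{0..2 ^ n}. if j = dyadic_index n t then g (real_of_int j / 2 ^ n) else 0)"
      by (rule sum.cong) (auto simp: indicator_def)
    also have "\<dots> = g (real_of_int (dyadic_index n t) / 2 ^ n)" using j by simp
    also have "\<dots> = g t" by (rule assms) simp
    finally show "(\<Sum>j\<in>{0..2 ^ n}. indicat_real (?C j) t *\<^sub>R g (real_of_int j / 2 ^ n)) = g t" .
  qed
qed

text \<open>
  Off a small open set, \<open>f\<close> oscillates by at most \<open>\<epsilon>\<close> on each cell of some dyadic level. The
  approximating step function is left implicit, since the values of \<open>f\<close> provide one that inherits any
  bound on \<open>f\<close>. Excluding the end points of cells makes the index of the cell locally constant off \<open>U\<close>.
\<close>
definition step_approximable :: "(real \<Rightarrow> 'a::real_normed_vector) \<Rightarrow> bool" where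
  "step_approximable f \<longleftrightarrow> (\<forall>\<epsilon>>0. \<exists>U n. open U \<and> U \<in> lmeasurable \<and> measure lebesgue U < \<epsilon> \<and>
     (\<forall>t\<in>{0..1} - U. 2 ^ n * t \<notin> \<int>) \<and>
     (\<forall>s\<in>{0..1} - U. \<forall>t\<in>{0..1} - U. dyadic_index n s = dyadic_index n t \<longrightarrow> norm (f s - f t) \<le> \<epsilon>))"

lemma integral_error_bound:
  fixes U :: "real set"
  assumes "U \<in> lmeasurable" "M \<ge> 0"
  shows "(\<lambda>s. \<epsilon> + 2 * M * indicat_real U s) integrable_on {0..1}"
    and "integral {0..1} (\<lambda>s. \<epsilon> + 2 * M * indicat_real U s) \<le> \<epsilon> + 2 * M * measure lebesgue U"
proof -
  have Ui: "U \<inter> {0..1} \<in> lmeasurable"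
    using assms(1) by (intro fmeasurable.Int bounded_set_imp_lmeasurable[of "{0..1}"]) auto
  then have ind: "indicat_real U integrable_on {0..1}" by (simp add: integrable_on_indicator)
  then have mind: "(\<lambda>s. 2 * M * indicat_real U s) integrable_on {0..1}"
    by (rule integrable_on_mult_right)
  then show "(\<lambda>s. \<epsilon> + 2 * M * indicat_real U s) integrable_on {0..1}"
    by (intro integrable_add) auto
  have "integral {0..1} (\<lambda>s. \<epsilon> + 2 * M * indicat_real U s) = \<epsilon> + 2 * M * integral {0..1} (indicat_real U)"
    using mind by (subst integral_add) auto
  also have "integral {0..1} (indicat_real U) = measure lebesgue (U \<inter> {0..1})"
    using Ui by (rule integral_indicator)
  also have "\<dots> \<le> measure lebesgue U"
    using assms Ui by (intro measure_mono_fmeasurable) (auto simp: fmeasurable_def)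
  finally show "integral {0..1} (\<lambda>s. \<epsilon> + 2 * M * indicat_real U s) \<le> \<epsilon> + 2 * M * measure lebesgue U"
    using assms(2) by (simp add: mult_left_mono)
qed

text \<open>
  The tolerance \<open>e / (2 * (1 + 2 * M))\<close> is used both for the oscillation and for the measure of the
  exceptional set.
\<close>
lemma error_size:
  fixes M e m :: real
  assumes "e > 0" "M \<ge> 0" "m < e / (2 * (1 + 2 * M))"
  shows "e / (2 * (1 + 2 * M)) + 2 * M * m < e"
proof -
  define \<eta> where "\<eta> = e / (2 * (1 + 2 * M))"
  have "2 * M * m \<le> 2 * M * \<eta>" using assms by (intro mult_left_mono) (auto simp: \<eta>_def)
  then have "\<eta> + 2 * M * m \<le> \<eta> * (1 + 2 * M)" by (simp add: algebra_simps)
  also have "\<dots> = e / 2" using assms by (simp add: \<eta>_def field_simps add_pos_nonneg)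
  also have "\<dots> < e" using assms by simp
  finally show ?thesis by (simp add: \<eta>_def)
qed

text \<open>
  The approximant takes on each cell a value of \<open>f\<close> off \<open>U\<close>, or zero if the cell lies in \<open>U\<close>. It differs
  from \<open>f\<close> by at most the tolerance off \<open>U\<close>, and by at most \<open>2 * M\<close> on \<open>U\<close>.
\<close>
lemma step_approximable_integrable:
  fixes f :: "real \<Rightarrow> 'a::banach"
  assumes f: "step_approximable f" and M: "\<And>t. t \<in> {0..1} \<Longrightarrow> norm (f t) \<le> M"
  shows "f integrable_on {0..1}"
proof -
  have M0: "M \<ge> 0" using M[of 0] norm_ge_zero[of "f 0"] by (simp add: order_trans[OF norm_ge_zero])
  have "f integrable_on cbox 0 1"
  proof (rule integrable_if_integrably_approximable)
    fix e :: real assume e: "e > 0"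
    define \<eta> where "\<eta> = e / (2 * (1 + 2 * M))"
    have "\<eta> > 0" using e M0 by (simp add: \<eta>_def)
    then obtain U n where U: "U \<in> lmeasurable" "measure lebesgue U < \<eta>"
      and close: "\<And>s t. s \<in> {0..1} - U \<Longrightarrow> t \<in> {0..1} - U \<Longrightarrow> dyadic_index n s = dyadic_index n t \<Longrightarrow> norm (f s - f t) \<le> \<eta>"
      using f unfolding step_approximable_def by metis
    define S where "S t = {s \<in> {0..1} - U. dyadic_index n s = dyadic_index n t}" for t
    define g where "g t = (if S t = {} then 0 else f (SOME s. s \<in> S t))" for t
    have gS: "\<exists>s\<in>S t. g t = f s" if "S t \<noteq> {}" for t
      using that some_in_eq[of "S t"] by (auto simp: g_def)
    have g: "g integrable_on {0..1}"
    proof (rule dyadic_step_integrable[of n])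
      fix s t assume "dyadic_index n s = dyadic_index n t"
      then have "S s = S t" by (simp add: S_def)
      then show "g s = g t" by (simp add: g_def)
    qed
    have "norm (f t - g t) \<le> \<eta> + 2 * M * indicat_real U t" if t: "t \<in> {0..1}" for t
    proof (cases "t \<in> U")
      case True
      have "norm (g t) \<le> M"
      proof (cases "S t = {}")
        case True then show ?thesis using M0 by (simp add: g_def)
      next
        case False then show ?thesis using gS[OF False] M by (auto simp: S_def)
      qed
      then have "norm (f t - g t) \<le> M + M" using M[OF t] norm_triangle_ineq4[of "f t" "g t"] by linarith
      then show ?thesis using True \<open>\<eta> > 0\<close> by simp
    next
      case False
      then have "t \<in> S t" using t by (simp add: S_def)
      then obtain s where "s \<in> S t" "g t = f s" using gS by blast
      then show ?thesis using close[of t s] t False by (auto simp: S_def)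
    qed
    moreover have "integral {0..1} (\<lambda>s. \<eta> + 2 * M * indicat_real U s) < e"
      using integral_error_bound(2)[OF U(1) M0, of \<eta>] error_size[OF e M0 U(2)[unfolded \<eta>_def]]
      unfolding \<eta>_def by linarith
    ultimately show "\<exists>g h. g integrable_on cbox 0 1 \<and> h integrable_on cbox 0 1 \<and>
      (\<forall>x\<in>cbox 0 1. norm (f x - g x) \<le> h x) \<and> integral (cbox 0 1) h < e"
      using g integral_error_bound(1)[OF U(1) M0, of \<eta>] unfolding box_real by blast
  qed
  then show ?thesis by simp
qed

lemma sum_integral_tagged_partition:
  fixes h :: "real \<Rightarrow> 'a::banach"
  assumes P: "tagged_partition P" and h: "h integrable_on {0..1}"
  shows "(\<Sum>(I, t)\<in>P. integral I h) = integral {0..1} h"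
proof -
  have I: "\<exists>a b. fst p = {a..b} \<and> a < b \<and> 0 \<le> a \<and> b \<le> 1" if "p \<in> P" for p
    using P that by (cases p) (fastforce simp: tagged_partition_def subintervals_def)
  have non: "interior (fst p) \<inter> interior (fst q) = {}" if "p \<in> P" "q \<in> P" "p \<noteq> q" for p q
    using P that by (auto simp: tagged_partition_def pairwise_def nonoverlapping_def)
  have inj: "inj_on fst P"
  proof (rule inj_onI, rule ccontr)
    fix p q assume pq: "p \<in> P" "q \<in> P" "fst p = fst q" "p \<noteq> q"
    then have "interior (fst p) = {}" using non[of p q] by simp
    then show False using I[OF pq(1)] by auto
  qed
  have "(fst ` P) division_of {0..1}"
  proof (rule division_ofI)
    show "finite (fst ` P)" using P by (simp add: tagged_partition_def)
    show "\<Union>(fst ` P) = {0..1}" using P by (simp add: tagged_partition_def split_beta)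
    fix K assume "K \<in> fst ` P"
    then obtain a b where "K = {a..b}" "a < b" "0 \<le> a" "b \<le> 1" using I by blast
    then show "K \<subseteq> {0..1}" "K \<noteq> {}" "\<exists>a b. K = cbox a b" by auto
  next
    fix K L assume "K \<in> fst ` P" "L \<in> fst ` P" "K \<noteq> L"
    then show "interior K \<inter> interior L = {}" using non by fastforce
  qed
  then have "integral {0..1} h = (\<Sum>K\<in>fst ` P. integral K h)"
    using h by (intro integral_combine_division_topdown)
  also have "\<dots> = (\<Sum>(I, t)\<in>P. integral I h)"
    by (subst sum.reindex[OF inj]) (simp add: split_beta o_def)
  finally show ?thesis by simp
qed

lemma hausdorff_distance_singletons: "hausdorff_distance {x} {y} = dist x y"
  by (simp add: hausdorff_distance_def dist_commute)

lemma finitely_additive_integral: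
  fixes f :: "real \<Rightarrow> 'a::banach"
  assumes "f integrable_on {0..1}"
  shows "finitely_additive (\<lambda>I. {integral I f})"
  unfolding finitely_additive_def
proof (intro ballI impI)
  fix I J assume IJ: "I \<in> subintervals" "J \<in> subintervals" "nonoverlapping I J \<and> I \<union> J \<in> subintervals"
  then obtain a b c d where ab: "I = {a..b}" "0 \<le> a" "b \<le> 1" and cd: "J = {c..d}" "0 \<le> c" "d \<le> 1"
    unfolding subintervals_def by blast
  have "f integrable_on I" "f integrable_on J"
    using assms ab cd by (auto intro: integrable_subinterval_real)
  moreover have "negligible (I \<inter> J)"
  proof -
    have "interior (I \<inter> J) = {}" using IJ by (simp add: nonoverlapping_def)
    then have "box (max a c) (min b d) = {}"
      using ab cd interior_cbox[of "max a c" "min b d"] by (simp add: Int_atLeastAtMost)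
    then have "negligible (cbox (max a c) (min b d))" by (simp only: negligible_interval)
    then show ?thesis using ab cd by (simp add: Int_atLeastAtMost)
  qed
  ultimately show "{integral (I \<union> J) f} = {integral I f} + {integral J f}"
    by (auto simp: set_plus_def)
qed

lemma dyadic_index_locally_constant:
  assumes "2 ^ n * t \<notin> \<int>"
  obtains d where "d > 0" "\<And>s. \<bar>s - t\<bar> < d \<Longrightarrow> dyadic_index n s = dyadic_index n t"
proof
  define x where "x = 2 ^ n * t"
  define d where "d = min (frac x) (1 - frac x)"
  have "frac x > 0" using assms by (simp add: x_def frac_gt_0_iff)
  then have d: "d > 0" using frac_lt_1[of x] by (simp add: d_def)
  then show "d / 2 ^ n > 0" by simp
  fix s assume "\<bar>s - t\<bar> < d / 2 ^ n"
  then have "2 ^ n * \<bar>s - t\<bar> < d" by (simp add: field_simps)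
  then have "\<bar>2 ^ n * s - x\<bar> < d" by (simp add: x_def abs_mult right_diff_distrib[symmetric])
  then show "dyadic_index n s = dyadic_index n t"
    unfolding x_def[symmetric] d_def frac_def by (intro floor_unique) linarith+
qed

text \<open>
  For \<open>t\<close> in \<open>U\<close> the gauge keeps the neighbourhood of \<open>t\<close> inside \<open>U\<close>; for other \<open>t\<close> it keeps it inside
  one dyadic cell. In both cases \<open>norm (f s - f t) \<le> h s\<close> holds near \<open>t\<close>, with an \<open>h\<close> that does
  not depend on \<open>t\<close>. It applies to every interval inside the gauge neighbourhood of its tag, whether or
  not the tag lies in the interval, and so to McShane partitions.
\<close>
lemma step_approximable_McShane:
  fixes f :: "real \<Rightarrow> 'a::banach"
  assumes f: "step_approximable f" and M: "\<And>t. t \<in> {0..1} \<Longrightarrow> norm (f t) \<le> M"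
  shows "variationally_McShane_integrable_fun f"
proof -
  have M0: "M \<ge> 0" using M[of 0] by (simp add: order_trans[OF norm_ge_zero])
  have int: "f integrable_on {0..1}" by (rule step_approximable_integrable[OF f M])
  have "\<exists>\<delta>. (\<forall>t\<in>{0..1}. \<delta> t > 0) \<and> (\<forall>P. tagged_partition P \<and> gauge_fine \<delta> P \<longrightarrow>
      (\<Sum>(I, t)\<in>P. hausdorff_distance {integral I f} ((*\<^sub>R) (measure lborel I) ` {f t})) < e)"
    if e: "e > 0" for e
  proof -
    define \<eta> where "\<eta> = e / (2 * (1 + 2 * M))"
    have \<eta>: "\<eta> > 0" using e M0 by (simp add: \<eta>_def)
    obtain U n where "open U" and U: "U \<in> lmeasurable" "measure lebesgue U < \<eta>"
      and nodes: "\<And>t. t \<in> {0..1} - U \<Longrightarrow> 2 ^ n * t \<notin> \<int>"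
      and close: "\<And>s t. s \<in> {0..1} - U \<Longrightarrow> t \<in> {0..1} - U \<Longrightarrow> dyadic_index n s = dyadic_index n t \<Longrightarrow> norm (f s - f t) \<le> \<eta>"
      using f \<eta> unfolding step_approximable_def by metis
    define h where "h s = \<eta> + 2 * M * indicat_real U s" for s
    have far: "norm (f s - f t) \<le> h s" if "s \<in> U \<inter> {0..1}" "t \<in> {0..1}" for s t
    proof -
      have "norm (f s - f t) \<le> M + M"
        using M[of s] M[of t] norm_triangle_ineq4[of "f s" "f t"] that by force
      then show ?thesis using that \<eta> by (simp add: h_def)
    qed
    have "\<exists>d>0. \<forall>s\<in>{0..1}. \<bar>s - t\<bar> < d \<longrightarrow> norm (f s - f t) \<le> h s" if t: "t \<in> {0..1}" for t
    proof (cases "t \<in> U")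
      case True
      then obtain d where d: "d > 0" "ball t d \<subseteq> U" using \<open>open U\<close> open_contains_ball by blast
      have "norm (f s - f t) \<le> h s" if "s \<in> {0..1}" "\<bar>s - t\<bar> < d" for s
      proof -
        have "s \<in> ball t d" using that by (simp add: dist_real_def abs_minus_commute)
        then show ?thesis using far d t that by blast
      qed
      then show ?thesis using d by blast
    next
      case False
      then obtain d where d: "d > 0" "\<And>s. \<bar>s - t\<bar> < d \<Longrightarrow> dyadic_index n s = dyadic_index n t"
        using dyadic_index_locally_constant nodes t by (metis DiffI)
      have "norm (f s - f t) \<le> h s" if "s \<in> {0..1}" "\<bar>s - t\<bar> < d" for s
      proof (cases "s \<in> U")
        case True then show ?thesis using far that t by blast
      next
        case False
        then have "norm (f s - f t) \<le> \<eta>" using close d that t \<open>t \<notin> U\<close> by blast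
        then show ?thesis using False by (simp add: h_def)
      qed
      then show ?thesis using d by blast
    qed
    then obtain \<delta> where \<delta>: "\<And>t. t \<in> {0..1} \<Longrightarrow> \<delta> t > 0"
      and near: "\<And>s t. t \<in> {0..1} \<Longrightarrow> s \<in> {0..1} \<Longrightarrow> \<bar>s - t\<bar> < \<delta> t \<Longrightarrow> norm (f s - f t) \<le> h s"
      by metis
    have h_int: "h integrable_on {0..1}"
      unfolding h_def by (rule integral_error_bound(1)[OF U(1) M0])
    have h_small: "integral {0..1} h < e"
      using integral_error_bound(2)[OF U(1) M0, of \<eta>] error_size[OF e M0 U(2)[unfolded \<eta>_def]]
      unfolding h_def[abs_def] \<eta>_def by linarith
    have "(\<Sum>(I, t)\<in>P. hausdorff_distance {integral I f} ((*\<^sub>R) (measure lborel I) ` {f t})) < e"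
      if P: "tagged_partition P" "gauge_fine \<delta> P" for P
    proof -
      have "(\<Sum>(I, t)\<in>P. hausdorff_distance {integral I f} ((*\<^sub>R) (measure lborel I) ` {f t}))
          \<le> (\<Sum>(I, t)\<in>P. integral I h)"
      proof (rule sum_mono, clarify)
        fix I t assume It: "(I, t) \<in> P"
        then have "I \<in> subintervals" and t: "t \<in> {0..1}" using P by (auto simp: tagged_partition_def)
        then obtain a b where ab: "I = {a..b}" "0 \<le> a" "a < b" "b \<le> 1" by (auto simp: subintervals_def)
        have Id: "I \<subseteq> {t - \<delta> t <..< t + \<delta> t}" using P It by (auto simp: gauge_fine_def)
        have fI: "f integrable_on I" using int ab by (auto intro: integrable_subinterval_real)
        have hI: "h integrable_on I" using h_int ab by (auto intro: integrable_subinterval_real)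
        have "integral I f - measure lborel I *\<^sub>R f t = integral I (\<lambda>s. f s - f t)"
          using fI ab by (subst integral_diff) auto
        also have "norm \<dots> \<le> integral I h"
        proof (rule integral_norm_bound_integral)
          show "(\<lambda>s. f s - f t) integrable_on I" using fI ab by (intro integrable_diff) auto
          fix s assume s: "s \<in> I"
          then have "s \<in> {t - \<delta> t <..< t + \<delta> t}" using Id by blast
          then have "\<bar>s - t\<bar> < \<delta> t" by auto
          then show "norm (f s - f t) \<le> h s" using s ab t by (intro near) auto
        qed (rule hI)
        finally show "hausdorff_distance {integral I f} ((*\<^sub>R) (measure lborel I) ` {f t}) \<le> integral I h"
          by (simp add: hausdorff_distance_singletons dist_norm)
      qed
      also have "\<dots> = integral {0..1} h" by (rule sum_integral_tagged_partition[OF P(1) h_int])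
      finally show ?thesis using h_small by simp
    qed
    then show ?thesis using \<delta> by blast
  qed
  then show ?thesis
    unfolding variationally_McShane_integrable_fun_def variational_primitive_def
    by (intro exI[of _ "\<lambda>I. integral I f"] conjI allI impI finitely_additive_integral[OF int])
qed

text \<open>
  Real functions that are Henstock-Kurzweil integrable are measurable.
\<close>
lemma step_approximable_scalarly_measurable:
  fixes f :: "real \<Rightarrow> 'a::banach"
  assumes "step_approximable f" "\<And>t. t \<in> {0..1} \<Longrightarrow> norm (f t) \<le> M"
  shows "scalarly_measurable f"
  unfolding scalarly_measurable_def
proof
  fix x' :: "'a \<Rightarrow>\<^sub>L real"
  have "f integrable_on {0..1}" using assms by (rule step_approximable_integrable)
  then have "(blinfun_apply x' \<circ> f) integrable_on {0..1}"
    by (rule integrable_linear) (rule blinfun.bounded_linear_right)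
  then show "(\<lambda>t. blinfun_apply x' (f t)) \<in> borel_measurable (lebesgue_on {0..1})"
    unfolding o_def by (rule integrable_imp_measurable)
qed

section \<open>Selecting along dyadic approximations\<close>

lemma dyadic_index_coarsen:
  assumes "dyadic_index n s = dyadic_index n t" "m \<le> n"
  shows "dyadic_index m s = dyadic_index m t"
proof -
  have half: "dyadic_index k u = dyadic_index (Suc k) u div 2" for k u
    using dyadic_index_Suc[of k u] by (auto simp del: power_Suc)
  show ?thesis
    using assms(2,1)
  proof (induction rule: dec_induct)
    case (step k)
    have "dyadic_index k s = dyadic_index k t"
      unfolding half[of k] using step.prems by simp
    then show ?case by (rule step.IH)
  qed
qed

lemma geometric_Cauchy_limit:
  fixes x :: "nat \<Rightarrow> 'a::banach"
  assumes "\<And>k. k \<ge> m \<Longrightarrow> dist (x k) (x (Suc k)) \<le> 2 * (1/2) ^ k"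
  obtains l where "x \<longlonglongrightarrow> l" "dist (x m) l \<le> 4 * (1/2) ^ m"
proof -
  define y where "y i = x (Suc (m + i)) - x (m + i)" for i
  have y: "norm (y i) \<le> 2 * (1/2) ^ m * (1/2) ^ i" for i
    using assms[of "m + i"] by (simp add: y_def dist_norm norm_minus_commute power_add)
  have geo: "(\<lambda>i. 2 * (1/2::real) ^ m * (1/2) ^ i) sums (2 * (1/2) ^ m * 2)"
    using geometric_sums[of "1/2::real"] by (intro sums_mult) simp
  then have "summable y" using y by (intro summable_comparison_test'[OF sums_summable]) auto
  then have "(\<lambda>n. \<Sum>i<n. y i) \<longlonglongrightarrow> suminf y" by (rule summable_LIMSEQ)
  moreover have "(\<Sum>i<n. y i) = x (m + n) - x m" for n
    by (induction n) (simp_all add: y_def)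
  ultimately have "(\<lambda>n. x (m + n) - x m + x m) \<longlonglongrightarrow> suminf y + x m" by (intro tendsto_add) auto
  then have "x \<longlonglongrightarrow> suminf y + x m"
    by (intro LIMSEQ_offset[of x m]) (simp add: add.commute)
  moreover have "norm (suminf y) \<le> 2 * (1/2) ^ m * 2"
    using norm_suminf_le[of y, OF y sums_summable[OF geo]] sums_unique[OF geo] by simp
  ultimately show ?thesis using that[of "suminf y + x m"] by (simp add: dist_norm)
qed

text \<open>
  A nearest point of \<open>A\<close> up to the error \<open>e\<close>. Being a function of \<open>A\<close> and \<open>x\<close> alone, it sends data that
  are constant on dyadic cells to points that are constant on dyadic cells.
\<close>
definition near_point :: "real \<Rightarrow> 'a::metric_space set \<Rightarrow> 'a \<Rightarrow> 'a" where
  "near_point e A x = (SOME a. a \<in> A \<and> dist x a < infdist x A + e)"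

lemma near_point:
  assumes "A \<noteq> {}" "e > 0"
  shows "near_point e A x \<in> A" "dist x (near_point e A x) < infdist x A + e"
proof -
  have "\<exists>a. a \<in> A \<and> dist x a < infdist x A + e" using infdist_near[OF assms] by metis
  then have "near_point e A x \<in> A \<and> dist x (near_point e A x) < infdist x A + e"
    unfolding near_point_def by (rule someI_ex)
  then show "near_point e A x \<in> A" "dist x (near_point e A x) < infdist x A + e" by simp_all
qed

text \<open>
  The set is a countable union of intersections of dyadic cells, so \<open>P\<close> may be arbitrary.
\<close>
lemma sets_dyadic_index_pair:
  "{t. P (dyadic_index m t) (dyadic_index n t)} \<in> sets lborel"
proof -
  have idx: "{t. dyadic_index k t = j} \<in> sets lborel" for k j
  proof -
    have "(\<lambda>t. dyadic_index k t) -` {j} \<inter> space borel \<in> sets borel"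
      by (rule measurable_sets[of _ borel "count_space UNIV"]) auto
    then show ?thesis by (simp add: vimage_def)
  qed
  have "{t. P (dyadic_index m t) (dyadic_index n t)}
      = (\<Union>p\<in>{p. P (fst p) (snd p)}. {t. dyadic_index m t = fst p} \<inter> {t. dyadic_index n t = snd p})"
    by auto
  also have "\<dots> \<in> sets lborel" using idx by (intro sets.countable_UN'' sets.Int) auto
  finally show ?thesis .
qed

text \<open>
  Continuity from above turns Cauchy convergence almost everywhere into convergence off small sets:
  the exceptional sets decrease as \<open>n\<close> grows, and their intersection is null.
\<close>
lemma Cauchy_exceptional_sets_small:
  fixes D :: "nat \<Rightarrow> nat \<Rightarrow> real \<Rightarrow> real"
  assumes meas: "\<And>m m' c. {t\<in>{0..<1}. c < D m m' t} \<in> sets lborel"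
    and N: "negligible N"
    and conv: "\<And>t c. t \<in> {0..<1} - N \<Longrightarrow> c > 0 \<Longrightarrow> \<exists>n. \<forall>m\<ge>n. \<forall>m'\<ge>n. D m m' t \<le> c"
    and c: "c > 0" and e: "e > 0"
  obtains n where "{t\<in>{0..<1}. \<exists>m\<ge>n. \<exists>m'\<ge>n. c < D m m' t} \<in> sets lborel"
    "emeasure lborel {t\<in>{0..<1}. \<exists>m\<ge>n. \<exists>m'\<ge>n. c < D m m' t} < ennreal e"
proof -
  define A where "A n = {t\<in>{0..<1}. \<exists>m\<ge>n. \<exists>m'\<ge>n. c < D m m' t}" for n
  have A_eq: "A n = (\<Union>m\<in>{n..}. \<Union>m'\<in>{n..}. {t\<in>{0..<1}. c < D m m' t})" for n
    unfolding A_def by auto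
  have A_sets: "A n \<in> sets lborel" for n
    unfolding A_eq by (intro sets.countable_UN'' meas) auto
  have "decseq A" unfolding A_def decseq_def by (auto intro: order_trans)
  moreover have "emeasure lborel (A n) \<noteq> \<infinity>" for n
  proof -
    have "emeasure lborel (A n) \<le> emeasure lborel {0..<1::real}"
      by (rule emeasure_mono) (auto simp: A_def)
    also have "\<dots> < \<infinity>" by simp
    finally show ?thesis by simp
  qed
  ultimately have lim: "(\<lambda>n. emeasure lborel (A n)) \<longlonglongrightarrow> emeasure lborel (\<Inter>n. A n)"
    using A_sets by (intro Lim_emeasure_decseq) auto
  have "(\<Inter>n. A n) \<subseteq> N"
  proof
    fix t assume t: "t \<in> (\<Inter>n. A n)"
    show "t \<in> N"
    proof (rule ccontr)
      assume "t \<notin> N"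
      then obtain n where "\<forall>m\<ge>n. \<forall>m'\<ge>n. D m m' t \<le> c" using conv[of t c] t c by (auto simp: A_def)
      moreover have "t \<in> A n" using t by blast
      ultimately show False unfolding A_def mem_Collect_eq by (meson not_le)
    qed
  qed
  then have "negligible (\<Inter>n. A n)" using N negligible_subset by blast
  moreover have sets: "(\<Inter>n. A n) \<in> sets lborel" using A_sets by (intro sets.countable_INT) auto
  ultimately have "emeasure lborel (\<Inter>n. A n) = 0"
    by (simp add: negligible_iff_null_sets null_sets_def)
  then have "(\<lambda>n. emeasure lborel (A n)) \<longlonglongrightarrow> 0" using lim by simp
  moreover have "(0::ennreal) < ennreal e" using e by simp
  ultimately have "\<forall>\<^sub>F n in sequentially. emeasure lborel (A n) < ennreal e" by (rule order_tendstoD(2))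
  then obtain n where "emeasure lborel (A n) < ennreal e"
    using eventually_happens'[OF sequentially_bot] by blast
  with A_sets[of n] show ?thesis unfolding A_def by (rule that)
qed

text \<open>
  The points \<open>s k t\<close> follow the sets \<open>G (\<nu> k) t\<close>, each an almost nearest point to its predecessor.
  Since \<open>\<nu>\<close> increases and every choice depends only on the sets and the previous point, \<open>s k\<close> is
  constant on the cells of level \<open>\<nu> k\<close>. Off the tail \<open>V m\<close> of the exceptional sets consecutive points
  differ by at most \<open>2 * (1/2)^k\<close> for \<open>k \<ge> m\<close>. So \<open>s m\<close> is within \<open>4 * (1/2)^m\<close> of the limit, which gives
  both the convergence and the approximation by step functions.
\<close>
lemma selection_of_dyadic_limit:
  fixes K :: "nat \<Rightarrow> int \<Rightarrow> 'a::banach set" and \<Gamma> :: "real \<Rightarrow> 'a set"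
  assumes K: "\<And>n j. 0 \<le> j \<Longrightarrow> j < 2 ^ n \<Longrightarrow> bounded (K n j) \<and> K n j \<noteq> {}"
    and \<Gamma>: "\<And>t. t \<in> {0..1} \<Longrightarrow> closed (\<Gamma> t) \<and> bounded (\<Gamma> t) \<and> \<Gamma> t \<noteq> {}"
    and N: "negligible N"
    and lim: "\<And>t. t \<in> {0..<1} - N \<Longrightarrow>
      (\<lambda>n. hausdorff_distance (K n (dyadic_index n t)) (\<Gamma> t)) \<longlonglongrightarrow> 0"
  obtains f where "selection f \<Gamma>" "step_approximable f"
proof -
  define G where "G n t = K n (dyadic_index n t)" for n t
  have G: "bounded (G n t)" "G n t \<noteq> {}" if "t \<in> {0..<1}" for n t
    using K[of "dyadic_index n t" n] dyadic_index_range[of t n] that by (auto simp: G_def)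
  define D where "D m m' t = hausdorff_distance (G m t) (G m' t)" for m m' t
  have meas: "{t\<in>{0..<1}. c < D m m' t} \<in> sets lborel" for m m' c
  proof -
    have "{t\<in>{0..<1}. c < D m m' t} = {0..<1} \<inter> {t. c < D m m' t}" by auto
    then show ?thesis unfolding D_def G_def
      using sets_dyadic_index_pair[of "\<lambda>i j. c < hausdorff_distance (K m i) (K m' j)" m m'] by simp
  qed
  have conv: "\<exists>n. \<forall>m\<ge>n. \<forall>m'\<ge>n. D m m' t \<le> c" if t: "t \<in> {0..<1} - N" and c: "c > 0" for t c
  proof -
    have "c / 2 > 0" using c by simp
    then have "\<forall>\<^sub>F n in sequentially. hausdorff_distance (G n t) (\<Gamma> t) < c / 2"
      using order_tendstoD(2)[OF lim[OF t]] unfolding G_def by blast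
    then obtain n where n: "\<And>m. m \<ge> n \<Longrightarrow> hausdorff_distance (G m t) (\<Gamma> t) < c / 2"
      unfolding eventually_sequentially by blast
    have "D m m' t \<le> c" if "m \<ge> n" "m' \<ge> n" for m m'
    proof -
      have "D m m' t \<le> hausdorff_distance (G m t) (\<Gamma> t) + hausdorff_distance (\<Gamma> t) (G m' t)"
        unfolding D_def using t G[of t] \<Gamma>[of t] by (intro hausdorff_distance_triangle) auto
      then show ?thesis
        using n[OF that(1)] n[OF that(2)] hausdorff_distance_commute[of "\<Gamma> t" "G m' t"] by linarith
    qed
    then show ?thesis by blast
  qed
  define A where "A k n = {t\<in>{0..<1}. \<exists>m\<ge>n. \<exists>m'\<ge>n. (1/2) ^ k < D m m' t}" for k n
  have "\<exists>n. A k n \<in> sets lborel \<and> emeasure lborel (A k n) < ennreal ((1/2) ^ k)" for k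
  proof -
    have p: "(1/2::real) ^ k > 0" by simp
    show ?thesis
    proof (rule Cauchy_exceptional_sets_small[OF meas N _ p p])
      fix t c assume "t \<in> {0..<1} - N" "(0::real) < c"
      then show "\<exists>n. \<forall>m\<ge>n. \<forall>m'\<ge>n. D m m' t \<le> c" by (rule conv)
    next
      fix n
      assume "{t\<in>{0..<1}. \<exists>m\<ge>n. \<exists>m'\<ge>n. (1/2) ^ k < D m m' t} \<in> sets lborel"
        "emeasure lborel {t\<in>{0..<1}. \<exists>m\<ge>n. \<exists>m'\<ge>n. (1/2) ^ k < D m m' t} < ennreal ((1/2) ^ k)"
      then show ?thesis unfolding A_def by (intro exI conjI)
    qed
  qed
  then obtain \<nu>0 where \<nu>0: "\<And>k. emeasure lborel (A k (\<nu>0 k)) < ennreal ((1/2) ^ k)"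
    "\<And>k. A k (\<nu>0 k) \<in> sets lborel" by metis
  \<comment> \<open>Beyond \<open>\<nu>0 k\<close> all the sets \<open>G n t\<close> are \<open>(1/2)^k\<close> close; increasing levels refine the cells.\<close>
  define \<nu> where "\<nu> k = k + (\<Sum>i\<le>k. \<nu>0 i)" for k
  have \<nu>0_le: "\<nu>0 k \<le> \<nu> k" for k
    unfolding \<nu>_def by (rule trans_le_add2, rule member_le_sum) auto
  have \<nu>_Suc: "\<nu> k < \<nu> (Suc k)" for k by (simp add: \<nu>_def)
  have \<nu>_mono: "strict_mono \<nu>" using \<nu>_Suc by (simp add: strict_mono_Suc_iff)
  define s where "s = rec_nat (\<lambda>t. near_point 1 (G (\<nu> 0) t) 0)
      (\<lambda>k u t. near_point ((1/2) ^ k) (G (\<nu> (Suc k)) t) (u t))"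
  have s_0: "s 0 t = near_point 1 (G (\<nu> 0) t) 0" for t by (simp add: s_def)
  have s_Suc: "s (Suc k) t = near_point ((1/2) ^ k) (G (\<nu> (Suc k)) t) (s k t)" for k t
    by (simp add: s_def)
  have s_in: "s k t \<in> G (\<nu> k) t" if "t \<in> {0..<1}" for k t
    by (cases k) (auto simp: s_0 s_Suc intro!: near_point(1) G(2)[OF that])
  have s_cell: "s k u = s k t" if "dyadic_index (\<nu> k) u = dyadic_index (\<nu> k) t" for k u t
    using that
  proof (induction k)
    case 0 then show ?case by (simp add: s_0 G_def)
  next
    case (Suc k)
    have "dyadic_index (\<nu> k) u = dyadic_index (\<nu> k) t"
      by (rule dyadic_index_coarsen[OF Suc.prems]) (rule less_imp_le[OF \<nu>_Suc])
    then show ?case using Suc by (simp add: s_Suc G_def)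
  qed
  have s_step: "dist (s k t) (s (Suc k) t) \<le> 2 * (1/2) ^ k" if t: "t \<in> {0..<1}" "t \<notin> A k (\<nu>0 k)" for k t
  proof -
    have "\<nu>0 k \<le> \<nu> (Suc k)" using \<nu>0_le[of k] \<nu>_Suc[of k] by simp
    then have "D (\<nu> k) (\<nu> (Suc k)) t \<le> (1/2) ^ k"
      using t \<nu>0_le[of k] unfolding A_def mem_Collect_eq by (meson not_less)
    moreover have "infdist (s k t) (G (\<nu> (Suc k)) t) \<le> D (\<nu> k) (\<nu> (Suc k)) t"
      unfolding D_def by (intro infdist_le_hausdorff_distance G s_in t)
    moreover have "dist (s k t) (s (Suc k) t) < infdist (s k t) (G (\<nu> (Suc k)) t) + (1/2) ^ k"
      unfolding s_Suc by (intro near_point(2) G t) simp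
    ultimately show ?thesis by linarith
  qed
  define V where "V m = (\<Union>i. A (m + i) (\<nu>0 (m + i)))" for m
  have s_lim: "\<exists>l\<in>\<Gamma> t. (\<lambda>k. s k t) \<longlonglongrightarrow> l \<and> dist (s m t) l \<le> 4 * (1/2) ^ m"
    if t: "t \<in> {0..<1} - (V m \<union> N)" for t m
  proof -
    have "dist (s k t) (s (Suc k) t) \<le> 2 * (1/2) ^ k" if "k \<ge> m" for k
    proof (rule s_step)
      have "t \<notin> A (m + (k - m)) (\<nu>0 (m + (k - m)))" using t unfolding V_def by blast
      then show "t \<notin> A k (\<nu>0 k)" using that by simp
    qed (use t in simp)
    then obtain l where l: "(\<lambda>k. s k t) \<longlonglongrightarrow> l" "dist (s m t) l \<le> 4 * (1/2) ^ m"
      by (rule geometric_Cauchy_limit)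
    have t1: "t \<in> {0..<1}" "t \<in> {0..1}" "t \<in> {0..<1} - N" using t by auto
    have "(\<lambda>k. infdist (s k t) (\<Gamma> t)) \<longlonglongrightarrow> infdist l (\<Gamma> t)" using l(1) by (rule tendsto_infdist)
    moreover have "(\<lambda>k. infdist (s k t) (\<Gamma> t)) \<longlonglongrightarrow> 0"
    proof (rule tendsto_sandwich[OF _ _ tendsto_const])
      show "(\<lambda>k. hausdorff_distance (G (\<nu> k) t) (\<Gamma> t)) \<longlonglongrightarrow> 0"
        using LIMSEQ_subseq_LIMSEQ[OF lim[OF t1(3)] \<nu>_mono] by (simp add: o_def G_def)
      show "\<forall>\<^sub>F k in sequentially. 0 \<le> infdist (s k t) (\<Gamma> t)" by (simp add: infdist_nonneg)
      show "\<forall>\<^sub>F k in sequentially. infdist (s k t) (\<Gamma> t) \<le> hausdorff_distance (G (\<nu> k) t) (\<Gamma> t)"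
        using G[OF t1(1)] \<Gamma>[OF t1(2)] s_in[OF t1(1)]
        by (intro always_eventually allI infdist_le_hausdorff_distance) auto
    qed
    ultimately have "infdist l (\<Gamma> t) = 0" by (rule LIMSEQ_unique)
    then have "l \<in> \<Gamma> t" using \<Gamma>[OF t1(2)] in_closed_iff_infdist_zero by blast
    then show ?thesis using l by blast
  qed
  define f where "f t = (if \<exists>l\<in>\<Gamma> t. (\<lambda>k. s k t) \<longlonglongrightarrow> l then lim (\<lambda>k. s k t) else SOME x. x \<in> \<Gamma> t)" for t
  have f_lim: "f t = l" if "l \<in> \<Gamma> t" "(\<lambda>k. s k t) \<longlonglongrightarrow> l" for t l
    using that limI[OF that(2)] unfolding f_def by auto
  have sel: "selection f \<Gamma>"
    unfolding selection_def
  proof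
    fix t :: real assume t: "t \<in> {0..1}"
    show "f t \<in> \<Gamma> t"
    proof (cases "\<exists>l\<in>\<Gamma> t. (\<lambda>k. s k t) \<longlonglongrightarrow> l")
      case True then show ?thesis using f_lim by blast
    next
      case False
      then have "f t = (SOME x. x \<in> \<Gamma> t)" unfolding f_def by (rule if_not_P)
      then show ?thesis using \<Gamma>[OF t] some_in_eq by auto
    qed
  qed
  have V_sets: "V m \<in> sets lborel" for m
    unfolding V_def using \<nu>0(2) by (intro sets.countable_UN) auto
  have V_small: "emeasure lborel (V m) \<le> ennreal (2 * (1/2) ^ m)" for m
  proof -
    have "emeasure lborel (V m) \<le> (\<Sum>i. emeasure lborel (A (m + i) (\<nu>0 (m + i))))"
      unfolding V_def using \<nu>0(2) by (intro emeasure_subadditive_countably) auto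
    also have "\<dots> \<le> (\<Sum>i. ennreal ((1/2) ^ (m + i)))"
      using \<nu>0(1) by (intro suminf_le less_imp_le) auto
    also have "\<dots> = ennreal (2 * (1/2) ^ m)"
    proof (rule suminf_ennreal_eq)
      have "(\<lambda>i. (1/2) ^ m * (1/2::real) ^ i) sums ((1/2) ^ m * 2)"
        using geometric_sums[of "1/2::real"] by (intro sums_mult) simp
      then show "(\<lambda>i. (1/2::real) ^ (m + i)) sums (2 * (1/2) ^ m)" by (simp add: power_add mult.commute)
    qed simp
    finally show ?thesis .
  qed
  have "step_approximable f"
    unfolding step_approximable_def
  proof (intro allI impI)
    fix e :: real assume e: "e > 0"
    have "(\<lambda>m. 8 * (1/2::real) ^ m) \<longlonglongrightarrow> 0"
      by (rule tendsto_mult_right_zero) (rule LIMSEQ_realpow_zero, simp_all)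
    then have "\<forall>\<^sub>F m in sequentially. 8 * (1/2::real) ^ m < e" using e by (rule order_tendstoD(2))
    then obtain m where m: "8 * (1/2::real) ^ m < e" by (auto simp: eventually_sequentially)
    \<comment> \<open>Removing the end points of cells also removes the point \<open>1\<close>, at which \<open>G\<close> is not controlled.\<close>
    define B where "B = {t\<in>{0..1::real}. 2 ^ \<nu> m * t \<in> \<int>}"
    have "B \<subseteq> (\<lambda>j. real_of_int j / 2 ^ \<nu> m) ` UNIV"
    proof
      fix t assume "t \<in> B"
      then obtain j where "2 ^ \<nu> m * t = real_of_int j" by (auto simp: B_def elim: Ints_cases)
      then have "t = real_of_int j / 2 ^ \<nu> m" by (simp add: field_simps)
      then show "t \<in> (\<lambda>j. real_of_int j / 2 ^ \<nu> m) ` UNIV" by blast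
    qed
    then have "countable B" by (rule countable_subset) simp
    then have "B \<in> null_sets lebesgue"
      by (intro null_sets_completionI countable_imp_null_set_lborel)
    then have BN: "B \<union> N \<in> null_sets lebesgue"
      using N unfolding negligible_iff_null_sets by (rule null_sets.Un)
    define S where "S = V m \<union> (B \<union> N)"
    have Vl: "V m \<in> sets lebesgue" using V_sets by simp
    have S_sets: "S \<in> sets lebesgue" unfolding S_def by (rule sets.Un[OF Vl null_setsD2[OF BN]])
    have "emeasure lebesgue S = emeasure lborel (V m)"
      unfolding S_def using emeasure_Un_null_set[OF Vl BN] V_sets by simp
    also have "\<dots> \<le> ennreal (e / 4)"
    proof (rule order_trans[OF V_small ennreal_leI])
      have "(0::real) < (1/2) ^ m" by simp
      then show "2 * (1/2) ^ m \<le> e / 4" using m by linarith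
    qed
    finally have S_small: "emeasure lebesgue S \<le> ennreal (e / 4)" .
    obtain U where U: "open U" "S \<subseteq> U" "U - S \<in> lmeasurable" "emeasure lebesgue (U - S) < ennreal (e / 2)"
      using sets_lebesgue_outer_open[OF S_sets, of "e / 2"] e by auto
    have "emeasure lebesgue U \<le> emeasure lebesgue S + emeasure lebesgue (U - S)"
    proof -
      have "U = S \<union> (U - S)" using U by auto
      then show ?thesis using emeasure_subadditive[OF S_sets fmeasurableD[OF U(3)]] by simp
    qed
    also have "\<dots> \<le> ennreal (e / 4) + ennreal (e / 2)"
      by (rule add_mono[OF S_small less_imp_le[OF U(4)]])
    also have "\<dots> = ennreal (e / 4 + e / 2)" using e by (intro ennreal_plus[symmetric]) auto
    also have "\<dots> < ennreal e" using e by (intro ennreal_lessI) auto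
    finally have emU: "emeasure lebesgue U < ennreal e" .
    have lmU: "U \<in> lmeasurable"
      using emU U(1) by (intro fmeasurableI) (auto intro: less_trans)
    have mU: "measure lebesgue U < e"
      using emU lmU e by (simp add: emeasure_eq_measure2 ennreal_less_iff)
    have 1: "2 ^ \<nu> m * t \<notin> \<int>" if "t \<in> {0..1} - U" for t
      using that U(2) by (auto simp: S_def B_def)
    have 2: "norm (f u - f t) \<le> e"
      if ut: "u \<in> {0..1} - U" "t \<in> {0..1} - U" "dyadic_index (\<nu> m) u = dyadic_index (\<nu> m) t" for u t
    proof -
      have dom: "v \<in> {0..<1} - (V m \<union> N)" if v: "v \<in> {0..1} - U" for v
      proof -
        have "v \<noteq> 1" using 1[OF v] by auto
        then show ?thesis using v U(2) by (auto simp: S_def)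
      qed
      have close: "dist (s m v) (f v) \<le> 4 * (1/2) ^ m" if v: "v \<in> {0..1} - U" for v
        using s_lim[OF dom[OF v]] f_lim by metis
      have "dist (f u) (f t) \<le> dist (s m u) (f u) + dist (s m u) (f t)"
        by (metis dist_commute dist_triangle)
      also have "dist (s m u) (f t) = dist (s m t) (f t)" by (simp add: s_cell[OF ut(3)])
      finally have "dist (f u) (f t) \<le> 4 * (1/2) ^ m + 4 * (1/2) ^ m"
        using close[OF ut(1)] close[OF ut(2)] by linarith
      then show ?thesis using m by (simp add: dist_norm)
    qed
    show "\<exists>U n. open U \<and> U \<in> lmeasurable \<and> measure lebesgue U < e \<and> (\<forall>t\<in>{0..1} - U. 2 ^ n * t \<notin> \<int>) \<and>
        (\<forall>s\<in>{0..1} - U. \<forall>t\<in>{0..1} - U. dyadic_index n s = dyadic_index n t \<longrightarrow> norm (f s - f t) \<le> e)"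
      by (rule exI[of _ U], rule exI[of _ "\<nu> m"]) (use U(1) lmU mU 1 2 in blast)
  qed
  then show ?thesis using that sel by blast
qed

section \<open>McShane integrable selections\<close>

text \<open>
  The supremum \<open>set_norm\<close> bounds the elements of \<open>\<Gamma> t\<close> because each value of \<open>\<Gamma>\<close> is bounded.
\<close>
lemma bounded_multifunction_bound:
  fixes \<Gamma> :: "real \<Rightarrow> 'a::real_normed_vector set"
  assumes "\<And>t. t \<in> {0..1} \<Longrightarrow> bounded (\<Gamma> t)" "bounded_multifunction \<Gamma>"
  obtains M where "\<And>t x. t \<in> {0..1} \<Longrightarrow> x \<in> \<Gamma> t \<Longrightarrow> norm x \<le> M"
proof -
  obtain M where M: "\<And>t. t \<in> {0..1} \<Longrightarrow> set_norm (\<Gamma> t) \<le> M"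
    using assms(2) unfolding bounded_multifunction_def bdd_above_def by blast
  have "norm x \<le> M" if t: "t \<in> {0..1}" and x: "x \<in> \<Gamma> t" for t x
  proof -
    have "bdd_above (norm ` \<Gamma> t)" using assms(1)[OF t] by (simp add: bounded_imp_bdd_above bounded_norm_comp)
    then have "norm x \<le> set_norm (\<Gamma> t)" unfolding set_norm_def using x by (rule cSUP_upper[rotated])
    then show ?thesis using M[OF t] by simp
  qed
  then show ?thesis using that by blast
qed

theorem theorem3p13:
  fixes \<Gamma> :: "real \<Rightarrow> 'a::banach set"
  assumes "\<forall>t\<in>{0..1}. \<Gamma> t \<in> cwk"
    and "bounded_multifunction \<Gamma>"
    and "variationally_Henstock_integrable \<Gamma>"
    and "Pettis_integrable \<Gamma>"
  shows "S_vMS \<Gamma> \<noteq> {}"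
proof -
  have \<Gamma>: "closed (\<Gamma> t) \<and> bounded (\<Gamma> t) \<and> \<Gamma> t \<noteq> {}" if "t \<in> {0..1}" for t
    using assms(1) that cwk_closed cwk_bounded cwk_nonempty by blast
  obtain \<Phi> where \<Phi>: "\<And>I. I \<in> subintervals \<Longrightarrow> \<Phi> I \<in> cwk"
    and prim: "variational_primitive perron_partition \<Phi> \<Gamma>"
    using assms(3) unfolding variationally_Henstock_integrable_def by blast
  define h where "h I t = hausdorff_distance (\<Phi> I) ((*\<^sub>R) (measure lborel I) ` \<Gamma> t)" for I t
  have h: "0 \<le> h I t" if "I \<in> subintervals" "t \<in> {0..1}" for I t
    unfolding h_def using \<Phi>[OF that(1)] \<Gamma>[OF that(2)]
    by (intro hausdorff_distance_nonneg) (auto simp: cwk_bounded cwk_nonempty)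
  have var: "\<exists>\<delta>. (\<forall>t\<in>{0..1}. \<delta> t > 0) \<and>
        (\<forall>P. perron_partition P \<and> gauge_fine \<delta> P \<longrightarrow> (\<Sum>(I, t)\<in>P. h I t) < \<epsilon>)" if "\<epsilon> > 0" for \<epsilon>
    using prim that unfolding variational_primitive_def h_def by blast
  obtain N where N: "negligible N"
    and h0: "\<And>t. t \<in> {0..<1} - N \<Longrightarrow> (\<lambda>n. 2 ^ n * h (dyadic n (dyadic_index n t)) t) \<longlonglongrightarrow> 0"
    using variation_on_cells_tendsto_zero[OF h var] by blast
  define K where "K n j = (*\<^sub>R) (1 / (1 / 2 ^ n)) ` \<Phi> (dyadic n j)" for n j
  have K: "bounded (K n j) \<and> K n j \<noteq> {}" if "0 \<le> j" "j < 2 ^ n" for n j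
    using \<Phi>[OF dyadic_in_subintervals[OF that]] unfolding K_def
    by (simp add: bounded_scaling cwk_bounded cwk_nonempty)
  have lim: "(\<lambda>n. hausdorff_distance (K n (dyadic_index n t)) (\<Gamma> t)) \<longlonglongrightarrow> 0" if t: "t \<in> {0..<1} - N" for t
  proof (rule tendsto_sandwich[OF _ _ tendsto_const h0[OF t]])
    have t1: "t \<in> {0..1}" "0 \<le> t" "t < 1" using t by auto
    show "\<forall>\<^sub>F n in sequentially. 0 \<le> hausdorff_distance (K n (dyadic_index n t)) (\<Gamma> t)"
      using K[OF dyadic_index_range[OF t1(2,3)]] \<Gamma>[OF t1(1)]
      by (intro always_eventually allI hausdorff_distance_nonneg) auto
    show "\<forall>\<^sub>F n in sequentially. hausdorff_distance (K n (dyadic_index n t)) (\<Gamma> t)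
        \<le> 2 ^ n * h (dyadic n (dyadic_index n t)) t"
    proof (intro always_eventually allI)
      fix n
      let ?I = "dyadic n (dyadic_index n t)"
      have "\<Phi> ?I \<in> cwk" by (intro \<Phi> dyadic_in_subintervals dyadic_index_range t1)
      then show "hausdorff_distance (K n (dyadic_index n t)) (\<Gamma> t) \<le> 2 ^ n * h ?I t"
        unfolding K_def using \<Gamma>[OF t1(1)]
        by (intro hausdorff_distance_scaleR_le) (simp_all add: cwk_bounded cwk_nonempty h_def measure_dyadic)
    qed
  qed
  obtain f where f: "selection f \<Gamma>" "step_approximable f"
    using selection_of_dyadic_limit[of K \<Gamma> N, OF K \<Gamma> N lim] by blast
  obtain M where "\<And>t x. t \<in> {0..1} \<Longrightarrow> x \<in> \<Gamma> t \<Longrightarrow> norm x \<le> M"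
    using bounded_multifunction_bound[OF _ assms(2)] \<Gamma> by metis
  then have M: "norm (f t) \<le> M" if "t \<in> {0..1}" for t
    using f(1) that unfolding selection_def by blast
  have "f \<in> S_vMS \<Gamma>"
    unfolding S_vMS_def
    using f(1) step_approximable_scalarly_measurable[OF f(2) M] step_approximable_McShane[OF f(2) M] by blast
  then show ?thesis by blast
qed

end
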